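(* Let $S$ be a symmetric subset of $\mathbb{R}^d$. Suppose the observed vectors $X_1,\dots,X_N\in\mathbb{R}^d$ are obtained by adversarial corruption of at most $|\mathcal{O}|$ of the independent random vectors $\tilde X_1,\dots,\tilde X_N$ in $\mathbb{R}^d$. Suppose that $\tilde X_1,\dots,\tilde X_N$ have mean $\mu^*$ and that there is a positive semi-definite matrix $\Sigma\in\mathbb{R}^{d\times d}$ such that $\mathbb{E}(\tilde X_i-\mu^* )(\tilde X_i-\mu^* )^\top\preceq\Sigma$ for every $i\in[N]$. Let $$r_S^*=\max\left(\frac{64}{\sqrt N}\,\mathbb{E}\left\|\frac{1}{\sqrt N}\sum_{i\in[N]}\epsilon_i(\tilde X_i-\mu^* )\right\|_S,\ \ \sup_{v\in S}\|\Sigma^{1/2}v\|_2\sqrt{\frac{64K}{N}}\right).$$ For all $K>16|\mathcal{O}|$, with probability at least $1-\exp(-K/512)$, $$\|\hat\mu_S^f-\mu^*\|_S\le 2r_S^*\quad\text{and}\quad\|\hat\mu_S^g-\mu^*\|_S\le 2r_S^*,$$ where $\hat\mu_S^f\in\operatorname{argmin}_{\mu\in\mathbb{R}^d}f_S^*(\mu)$ and $\hat\mu_S^g\in\operatorname{argmin}_{\mu\in\mathbb{R}^d}g_S^*(\mu)$, with $f_S^*$ and $g_S^*$ built from $X_1,\dots,X_N$ and $K$ blocks as defined in the context.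
   Context: Symmetric means $x\in S\Rightarrow -x\in S$; $\|x\|_S=\sup_{v\in S}\langle v,x\rangle$; $[N]=\{1,\dots,N\}$; $\|\cdot\|_2$ is the Euclidean norm; $\epsilon_1,\dots,\epsilon_N$ are i.i.d. Rademacher variables independent of $(\tilde X_i)_i$. Adversarial corruption: $\tilde X_1,\dots,\tilde X_N$ are independent random vectors. An adversary sees all of them and may modify up to $|\mathcal{O}|$ of them in an arbitrary way ($|\mathcal O|$ a fixed integer; the set $\mathcal{O}\subset[N]$ of modified indices and the modified values may depend arbitrarily on $(\tilde X_i)_i$). The result is $X_1,\dots,X_N$, with $X_i=\tilde X_i$ for $i\notin\mathcal{O}$. The statistician observes only $(X_i)_i$. Blocks: $[N]$ is partitioned into $K$ blocks $B_1,\dots,B_K$ of equal size $N/K$ (the partition is fixed in advance, not depending on the data), with $K+1$ divisible by $4$. Put $\bar X_k=|B_k|^{-1}\sum_{i\in B_k}X_i$. For $v\in\mathbb{R}^d$, let $\langle\bar X_k,v\rangle_{(1)}^*\le\dots\le\langle\bar X_k,v\rangle_{(K)}^*$ be the non-decreasing rearrangement of the real numbers $\langle\bar X_1,v\rangle,\dots,\langle\bar X_K,v\rangle$. With $I_K=\{k\in\mathbb{Z}:\frac{K+1}{4}\le k\le\frac{3(K+1)}{4}\}$, set $$f(v)=\frac1{|I_K|}\sum_{k\in I_K}\langle\bar X_k,v\rangle_{(k)}^*,\qquad g(v)=\mathrm{Med}(\langle\bar X_k,v\rangle)=\langle\bar X_k,v\rangle^*_{(\frac{K+1}{2})}.$$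 The Fenchel–Legendre transforms on $S$ are $f_S^*(\mu)=\sup_{v\in S}(\langle\mu,v\rangle-f(v))$ and $g_S^*(\mu)=\sup_{v\in S}(\langle\mu,v\rangle-g(v))$, $\mu\in\mathbb{R}^d$. *)

theory Defs
  imports "HOL-Probability.Probability"
begin

definition symmetric_set :: "(real ^ 'd) set \<Rightarrow> bool" where
  "symmetric_set S \<longleftrightarrow> (\<forall>x\<in>S. - x \<in> S)"

text \<open>The supremum defining the pseudo-norm is taken in the extended reals, since \<open>S\<close>
  need not be bounded.\<close>

definition pnorm :: "(real ^ 'd) set \<Rightarrow> real ^ 'd \<Rightarrow> ereal" where
  "pnorm S x = (SUP v\<in>S. ereal (v \<bullet> x))"

definition pos_semidef :: "real ^ 'd ^ 'd \<Rightarrow> bool" where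
  "pos_semidef A \<longleftrightarrow> transpose A = A \<and> (\<forall>x. 0 \<le> x \<bullet> (A *v x))"

definition loewner_le :: "real ^ 'd ^ 'd \<Rightarrow> real ^ 'd ^ 'd \<Rightarrow> bool" where
  "loewner_le A B \<longleftrightarrow> pos_semidef (B - A)"

text \<open>A positive semi-definite matrix has exactly one positive semi-definite square root, so
  for such matrices the choice operator below does not choose.\<close>

definition matrix_sqrt :: "real ^ 'd ^ 'd \<Rightarrow> real ^ 'd ^ 'd" where
  "matrix_sqrt A = (SOME R. pos_semidef R \<and> R ** R = A)"

definition outer_square :: "real ^ 'd \<Rightarrow> real ^ 'd ^ 'd" where
  "outer_square x = (\<chi> i j. x $ i * x $ j)"

definition rademacher :: "'a measure \<Rightarrow> ('a \<Rightarrow> real) \<Rightarrow> bool" where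
  "rademacher M Y \<longleftrightarrow> Y \<in> borel_measurable M \<and>
     measure M {\<omega> \<in> space M. Y \<omega> = 1} = 1 / 2 \<and>
     measure M {\<omega> \<in> space M. Y \<omega> = - 1} = 1 / 2"

text \<open>The library's \<open>indep_var\<close> requires both variables to take values in the same type.\<close>

definition indep_families ::
    "'a measure \<Rightarrow> 'i set \<Rightarrow> ('i \<Rightarrow> 'a \<Rightarrow> 'b::topological_space) \<Rightarrow> ('i \<Rightarrow> 'a \<Rightarrow> 'c::topological_space) \<Rightarrow> bool" where
  "indep_families M I U V \<longleftrightarrow> prob_space.indep_set M
     (sets (vimage_algebra (space M) (\<lambda>\<omega>. \<lambda>i\<in>I. U i \<omega>) (PiM I (\<lambda>_. borel))))
     (sets (vimage_algebra (space M) (\<lambda>\<omega>. \<lambda>i\<in>I. V i \<omega>) (PiM I (\<lambda>_. borel))))"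

definition equal_blocks :: "nat \<Rightarrow> nat \<Rightarrow> (nat \<Rightarrow> nat set) \<Rightarrow> bool" where
  "equal_blocks N K B \<longleftrightarrow> (\<Union>k\<in>{1..K}. B k) = {1..N} \<and> disjoint_family_on B {1..K} \<and>
     (\<forall>k\<in>{1..K}. real (card (B k)) = real N / real K)"

definition block_mean :: "(nat \<Rightarrow> real ^ 'd) \<Rightarrow> nat set \<Rightarrow> real ^ 'd" where
  "block_mean x J = (1 / real (card J)) *\<^sub>R (\<Sum>i\<in>J. x i)"

text \<open>The \<open>k\<close>-th smallest of \<open>a 1, \<dots>, a K\<close>, counted from \<open>1\<close> and with multiplicity.\<close>

definition order_stat :: "nat \<Rightarrow> (nat \<Rightarrow> real) \<Rightarrow> nat \<Rightarrow> real" where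
  "order_stat K a k = sort (map a [1..<Suc K]) ! (k - 1)"

definition mid_ranks :: "nat \<Rightarrow> nat set" where
  "mid_ranks K = {k. (real K + 1) / 4 \<le> real k \<and> real k \<le> 3 * (real K + 1) / 4}"

definition trimmed_block_mean ::
    "nat \<Rightarrow> (nat \<Rightarrow> nat set) \<Rightarrow> (nat \<Rightarrow> real ^ 'd) \<Rightarrow> real ^ 'd \<Rightarrow> real" where
  "trimmed_block_mean K B x v =
     (1 / real (card (mid_ranks K))) *
     (\<Sum>k\<in>mid_ranks K. order_stat K (\<lambda>j. block_mean x (B j) \<bullet> v) k)"

definition median_block_mean ::
    "nat \<Rightarrow> (nat \<Rightarrow> nat set) \<Rightarrow> (nat \<Rightarrow> real ^ 'd) \<Rightarrow> real ^ 'd \<Rightarrow> real" where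
  "median_block_mean K B x v = order_stat K (\<lambda>j. block_mean x (B j) \<bullet> v) ((K + 1) div 2)"

definition legendre_on :: "(real ^ 'd) set \<Rightarrow> (real ^ 'd \<Rightarrow> real) \<Rightarrow> real ^ 'd \<Rightarrow> ereal" where
  "legendre_on S h \<mu> = (SUP v\<in>S. ereal (\<mu> \<bullet> v - h v))"

text \<open>For nonempty symmetric \<open>S\<close> the values of \<^term>\<open>pnorm S\<close> are nonnegative, hence
  \<^const>\<open>e2ennreal\<close> loses nothing and the integral is the expectation, possibly infinite.\<close>

definition rademacher_complexity ::
    "'a measure \<Rightarrow> (real ^ 'd) set \<Rightarrow> nat \<Rightarrow> (nat \<Rightarrow> 'a \<Rightarrow> real) \<Rightarrow> (nat \<Rightarrow> 'a \<Rightarrow> real ^ 'd)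
      \<Rightarrow> real ^ 'd \<Rightarrow> ereal" where
  "rademacher_complexity M S N \<epsilon> Y \<mu> = enn2ereal (\<integral>\<^sup>+ \<omega>. e2ennreal (pnorm S
     ((1 / sqrt (real N)) *\<^sub>R (\<Sum>i\<in>{1..N}. \<epsilon> i \<omega> *\<^sub>R (Y i \<omega> - \<mu>)))) \<partial>M)"

definition rate ::
    "'a measure \<Rightarrow> (real ^ 'd) set \<Rightarrow> nat \<Rightarrow> nat \<Rightarrow> (nat \<Rightarrow> 'a \<Rightarrow> real) \<Rightarrow> (nat \<Rightarrow> 'a \<Rightarrow> real ^ 'd)
      \<Rightarrow> real ^ 'd \<Rightarrow> real ^ 'd ^ 'd \<Rightarrow> ereal" where
  "rate M S N K \<epsilon> Y \<mu> C = max
     (ereal (64 / sqrt (real N)) * rademacher_complexity M S N \<epsilon> Y \<mu>)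
     ((SUP v\<in>S. ereal (norm (matrix_sqrt C *v v))) * ereal (sqrt (64 * real K / real N)))"

end

theory Submission
  imports Defs
begin

text \<open>
  Call block \<open>k\<close> bad in direction \<open>v\<close> if its mean exceeds \<open>\<mu>\<close> in that direction by more than
  \<open>r\<close>. Put \<open>K + 1 = 4 m\<close>. If fewer than \<open>m\<close> blocks are bad in each direction \<open>v \<in> S\<close>, then, since
  \<open>- v \<in> S\<close> as well, every order statistic of \<open>\<langle>X\<^sub>k, v\<rangle>\<close> of rank between \<open>m\<close> and \<open>3 m\<close> lies within
  \<open>r\<close> of \<open>\<langle>\<mu>, v\<rangle>\<close> (\<open>block_estimators_close\<close>). So does the median, and so does the average of the
  middle order statistics. A function \<open>h\<close> on \<open>S\<close> with \<open>\<bar>h v - \<langle>\<mu>, v\<rangle>\<bar> \<le> r\<close> has Legendre transform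
  at most \<open>r\<close> at \<open>\<mu>\<close>, hence at most \<open>r\<close> at any minimizer \<open>\<nu>\<close>, and adding the two bounds gives
  \<open>\<langle>\<nu> - \<mu>, v\<rangle> \<le> 2 r\<close> (\<open>pnorm_arg_min_legendre_le\<close>).

  The adversary reaches fewer than \<open>K / 16\<close> blocks. It remains to see that, with probability at
  least \<open>1 - exp (- K / 512)\<close>, at most \<open>3 K / 16\<close> blocks of the clean sample are bad, for all
  directions at once. Indicators are replaced by a ramp that vanishes up to \<open>\<rho> / 2\<close> and equals \<open>1\<close>
  from \<open>\<rho>\<close> on, evaluated at the centred block sums \<open>W\<^sub>k\<close>, with \<open>\<rho> = r N / K\<close>. Outside an
  event of probability at most \<open>exp (- K / 512)\<close>, the supremum over \<open>v\<close> of the sum of the ramps is at most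
  \<open>K / 64 + K / 8 + K / 32 = 11 K / 64\<close>, by three estimates (\<open>prob_few_large_blocks\<close>).

  \<^item> Means: a ramp is bounded by the square of \<open>t / \<rho>\<close>, so its expectation is at most the second
    moment of \<open>\<langle>W\<^sub>k, v\<rangle>\<close> divided by \<open>\<rho>\<^sup>2\<close>. The part of the rate that involves \<open>\<Sigma>\<close> makes this at
    most \<open>1 / 64\<close>.

  \<^item> Expected fluctuation: symmetrization over the blocks, contraction (the ramp is
    \<open>2 / \<rho>\<close>-Lipschitz) and symmetrization over the observations in a block bound the expected
    supremum of the centred sum by \<open>8 / \<rho>\<close> times that of \<open>\<Sum>\<^sub>i \<epsilon>\<^sub>i \<langle>X\<^sub>i - \<mu>, v\<rangle>\<close>
    (\<open>expectation_max_blocks_le_symmetrized\<close>). The Rademacher part of the rate makes this at most \<open>K / 8\<close>.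

  \<^item> Concentration: changing one block moves the supremum by at most \<open>1\<close>, so by the bounded
    differences inequality it exceeds its mean by \<open>K / 32\<close> with probability at most
    \<open>exp (- 2 (K / 32)\<^sup>2 / K) = exp (- K / 512)\<close> (\<open>bounded_differences_ineq\<close>).

  Two devices keep the argument elementary. Symmetrization is done one summand at a time, in a
  form that is stable under adding any independent remainder, in place of an independent copy of
  the whole sample. And the suprema are maxima over finite subsets of \<open>S\<close>, with \<open>r\<close> slightly
  larger than the rate; letting the subsets exhaust a countable dense subset of \<open>S\<close> while \<open>r\<close>
  decreases to the rate gives a decreasing sequence of events whose intersection is the required
  event. This also covers a rate equal to \<open>0\<close>.
\<close>

section \<open>Maxima over a finite set of directions\<close>

definition max_over :: "'v set \<Rightarrow> ('v \<Rightarrow> real) \<Rightarrow> real" where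
  "max_over T h = Max (h ` T)"

context
  fixes T :: "'v set"
  assumes T: "finite T" "T \<noteq> {}"
begin

lemma max_over_ge: "v \<in> T \<Longrightarrow> h v \<le> max_over T h"
  using T by (simp add: max_over_def)

lemma max_over_attained: "\<exists>v\<in>T. max_over T h = h v"
proof -
  have "Max (h ` T) \<in> h ` T" using T by (intro Max_in) auto
  then show ?thesis by (auto simp: max_over_def)
qed

lemma max_over_le_iff: "max_over T h \<le> c \<longleftrightarrow> (\<forall>v\<in>T. h v \<le> c)"
  using T by (simp add: max_over_def)

lemma abs_max_over_le: "\<bar>max_over T h\<bar> \<le> (\<Sum>v\<in>T. \<bar>h v\<bar>)"
proof -
  obtain v where "v \<in> T" "max_over T h = h v" using max_over_attained by blast
  then show ?thesis using member_le_sum[of v T "\<lambda>v. \<bar>h v\<bar>"] T by simp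
qed

lemma max_over_scale: "0 \<le> c \<Longrightarrow> max_over T (\<lambda>v. c * h v) = c * max_over T h"
proof (rule antisym)
  assume c: "0 \<le> c"
  then show "max_over T (\<lambda>v. c * h v) \<le> c * max_over T h"
    by (simp add: max_over_le_iff mult_left_mono max_over_ge)
  obtain v where "v \<in> T" "max_over T h = h v" using max_over_attained by blast
  then show "c * max_over T h \<le> max_over T (\<lambda>v. c * h v)"
    using max_over_ge[of v "\<lambda>v. c * h v"] by simp
qed

lemma max_over_diff_le:
  assumes "\<And>v. v \<in> T \<Longrightarrow> h v \<le> h' v + c"
  shows "max_over T h \<le> max_over T h' + c"
  using assms max_over_ge[of _ h'] unfolding max_over_le_iff by (meson add_le_cancel_right order_trans)

lemma borel_measurable_max_over:
  assumes "\<And>v. v \<in> T \<Longrightarrow> (\<lambda>x. h x v) \<in> borel_measurable N"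
  shows "(\<lambda>x. max_over T (h x)) \<in> borel_measurable N"
  unfolding max_over_def using T assms by (intro borel_measurable_Max) auto

lemma integrable_max_over:
  assumes "\<And>v. v \<in> T \<Longrightarrow> integrable N (\<lambda>x. h x v)"
  shows "integrable N (\<lambda>x. max_over T (h x))"
proof (rule Bochner_Integration.integrable_bound)
  show "integrable N (\<lambda>x. \<Sum>v\<in>T. \<bar>h x v\<bar>)" using assms by auto
  show "(\<lambda>x. max_over T (h x)) \<in> borel_measurable N"
    using assms by (intro borel_measurable_max_over) auto
  show "AE x in N. norm (max_over T (h x)) \<le> norm (\<Sum>v\<in>T. \<bar>h x v\<bar>)"
    using abs_max_over_le by (auto simp: sum_nonneg)
qed

text \<open>
  With the two maxima attained at \<open>v\<close> and \<open>w\<close>, the left side is \<open>a v + a w + (p v - p w)\<close>, and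
  \<open>a v + a w + \<bar>q v - q w\<bar>\<close> is a lower bound of the right side, by giving \<open>q\<close> the better of the two
  signs at \<open>v\<close> and the other one at \<open>w\<close>.
\<close>

lemma max_over_contraction:
  assumes "\<And>v w. v \<in> T \<Longrightarrow> w \<in> T \<Longrightarrow> \<bar>p v - p w\<bar> \<le> \<bar>q v - q w\<bar>"
  shows "max_over T (\<lambda>v. a v + p v) + max_over T (\<lambda>v. a v - p v)
      \<le> max_over T (\<lambda>v. a v + q v) + max_over T (\<lambda>v. a v - q v)"
proof -
  obtain v where v: "v \<in> T" "max_over T (\<lambda>v. a v + p v) = a v + p v" using max_over_attained by blast
  obtain w where w: "w \<in> T" "max_over T (\<lambda>v. a v - p v) = a w - p w" using max_over_attained by blast
  have "\<bar>p v - p w\<bar> \<le> \<bar>q v - q w\<bar>" using assms v w by blast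
  moreover have "a v + q v \<le> max_over T (\<lambda>v. a v + q v)" "a w - q w \<le> max_over T (\<lambda>v. a v - q v)"
    "a w + q w \<le> max_over T (\<lambda>v. a v + q v)" "a v - q v \<le> max_over T (\<lambda>v. a v - q v)"
    using max_over_ge[OF v(1), of "\<lambda>v. a v + q v"] max_over_ge[OF v(1), of "\<lambda>v. a v - q v"]
      max_over_ge[OF w(1), of "\<lambda>v. a v + q v"] max_over_ge[OF w(1), of "\<lambda>v. a v - q v"] by auto
  ultimately show ?thesis unfolding v(2) w(2) by linarith
qed

text \<open>
  For each \<open>v\<close>, the argument of the maximum is the average of \<open>a v + 2 f x v\<close> and the mean of
  \<open>a v - 2 f x' v\<close> over an independent \<open>x'\<close>. Bounding both by the respective maxima and
  integrating over \<open>x\<close> symmetrizes a single summand. Since \<open>a\<close> is arbitrary, the same inequality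
  holds conditionally on all other summands.
\<close>

lemma expectation_max_symmetrize:
  assumes "prob_space N" and int: "\<And>v. v \<in> T \<Longrightarrow> integrable N (\<lambda>x. f x v)"
  shows "(\<integral>x. max_over T (\<lambda>v. a v + (f x v - (\<integral>x. f x v \<partial>N))) \<partial>N)
    \<le> ((\<integral>x. max_over T (\<lambda>v. a v + 2 * f x v) \<partial>N) + (\<integral>x. max_over T (\<lambda>v. a v - 2 * f x v) \<partial>N)) / 2"
proof -
  interpret prob_space N by fact
  define P where "P x = max_over T (\<lambda>v. a v + 2 * f x v)" for x
  define Q where "Q x = max_over T (\<lambda>v. a v - 2 * f x v)" for x
  have intP: "integrable N P" and intQ: "integrable N Q"
    unfolding P_def Q_def using int by (auto intro!: integrable_max_over)
  have Q: "a v - 2 * expectation (\<lambda>x. f x v) \<le> expectation Q" if v: "v \<in> T" for v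
  proof -
    have "a v - 2 * expectation (\<lambda>x. f x v) = expectation (\<lambda>x. a v - 2 * f x v)"
      using int[OF v] by (simp add: prob_space)
    also have "\<dots> \<le> expectation Q"
      using int[OF v] intQ max_over_ge[OF v] by (intro integral_mono) (auto simp: Q_def)
    finally show ?thesis .
  qed
  have "max_over T (\<lambda>v. a v + (f x v - expectation (\<lambda>x. f x v))) \<le> P x / 2 + expectation Q / 2" for x
    unfolding max_over_le_iff
  proof
    fix v assume v: "v \<in> T"
    have "a v + 2 * f x v \<le> P x" unfolding P_def using max_over_ge[OF v, of "\<lambda>v. a v + 2 * f x v"] .
    then show "a v + (f x v - expectation (\<lambda>x. f x v)) \<le> P x / 2 + expectation Q / 2"
      using Q[OF v] by linarith
  qed
  then have "expectation (\<lambda>x. max_over T (\<lambda>v. a v + (f x v - expectation (\<lambda>x. f x v))))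
      \<le> expectation (\<lambda>x. P x / 2 + expectation Q / 2)"
    using int intP by (intro integral_mono integrable_max_over) auto
  also have "\<dots> = (expectation P + expectation Q) / 2"
    using intP by (simp add: prob_space add_divide_distrib)
  finally show ?thesis unfolding P_def Q_def .
qed

lemma integrable_pair_add:
  assumes "prob_space A" "prob_space B" "integrable A u" "integrable B w"
  shows "integrable (A \<Otimes>\<^sub>M B) (\<lambda>z. u (fst z) + w (snd z) :: real)"
proof -
  interpret A: prob_space A by fact
  interpret B: prob_space B by fact
  interpret AB: pair_prob_space A B ..
  have "integrable (A \<Otimes>\<^sub>M B) (\<lambda>z. u (fst z))"
    using assms(3) B.distr_pair_fst[of A]
    by (intro integrable_distr[of fst _ A]) auto
  moreover have "integrable (A \<Otimes>\<^sub>M B) (\<lambda>z. w (snd z))"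
  proof (rule AB.integrable_product_swap_iff[THEN iffD1])
    have "integrable (B \<Otimes>\<^sub>M A) (\<lambda>z. w (fst z))"
      using assms(4) A.distr_pair_fst[of B]
      by (intro integrable_distr[of fst _ B]) auto
    then show "integrable (B \<Otimes>\<^sub>M A) (\<lambda>(x, y). w (snd (y, x)))"
      by (simp add: case_prod_unfold)
  qed
  ultimately show ?thesis by simp
qed

lemma integrable_PiM_component:
  assumes "\<And>i. prob_space (R i)" "j \<in> J" "integrable (R j) h"
  shows "integrable (PiM J R) (\<lambda>x. h (x j) :: real)"
  using assms distr_PiM_component[of J R j] by (intro integrable_distr[of "\<lambda>x. x j" "PiM J R" "R j"]) auto

lemma integrable_PiM_sum:
  fixes h :: "'i \<Rightarrow> 'b \<Rightarrow> 'v \<Rightarrow> real"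
  assumes "\<And>i. prob_space (R i)" "\<And>j. j \<in> J \<Longrightarrow> integrable (R j) (\<lambda>x. h j x v)"
  shows "integrable (PiM J R) (\<lambda>x. a + (\<Sum>j\<in>J. h j (x j) v))"
proof -
  interpret prob_space "PiM J R" by (intro prob_space_PiM assms)
  have "integrable (PiM J R) (\<lambda>x. h j (x j) v)" if "j \<in> J" for j
    using integrable_PiM_component[where h = "\<lambda>y. h j y v" and j = j and R = R and J = J] assms that by blast
  then show ?thesis by auto
qed

lemma sum_insert_fun_upd:
  assumes "finite J" "i \<notin> J"
  shows "(a :: real) + (\<Sum>j\<in>insert i J. h j ((x(i := y)) j) v) = a + (\<Sum>j\<in>J. h j (x j) v) + h i y v"
proof -
  have "(\<Sum>j\<in>J. h j ((x(i := y)) j) v) = (\<Sum>j\<in>J. h j (x j) v)"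
    using assms by (intro sum.cong) auto
  then show ?thesis using assms by simp
qed

text \<open>
  If replacing one summand increases the expected maximum for every deterministic shift, then
  replacing all independent summands does: the others act as a shift once they are fixed, by
  Fubini. Quantifying over all shifts \<open>a\<close> is what makes the induction on the summands work.
\<close>

lemma expectation_max_over_sum_mono_PiM:
  assumes J: "finite J"
    and P: "\<And>i. prob_space (P i)" and Q: "\<And>i. prob_space (Q i)"
    and f: "\<And>i v. i \<in> J \<Longrightarrow> v \<in> T \<Longrightarrow> integrable (P i) (\<lambda>x. f i x v)"
    and g: "\<And>i v. i \<in> J \<Longrightarrow> v \<in> T \<Longrightarrow> integrable (Q i) (\<lambda>x. g i x v)"
    and le: "\<And>i a. i \<in> J \<Longrightarrow> (\<integral>x. max_over T (\<lambda>v. a v + f i x v) \<partial>P i)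
                              \<le> (\<integral>x. max_over T (\<lambda>v. a v + g i x v) \<partial>Q i)"
  shows "(\<integral>x. max_over T (\<lambda>v. a v + (\<Sum>i\<in>J. f i (x i) v)) \<partial>PiM J P)
      \<le> (\<integral>x. max_over T (\<lambda>v. a v + (\<Sum>i\<in>J. g i (x i) v)) \<partial>PiM J Q)"
  using J f g le
proof (induction J arbitrary: a rule: finite_induct)
  case empty
  then show ?case by (simp add: PiM_empty lebesgue_integral_count_space_finite)
next
  case (insert i J)
  interpret P: product_prob_space P J
    by (intro product_prob_space.intro product_sigma_finite.intro product_prob_space_axioms.intro
        prob_space_imp_sigma_finite P)
  interpret Q: product_prob_space Q J
    by (intro product_prob_space.intro product_sigma_finite.intro product_prob_space_axioms.intro
        prob_space_imp_sigma_finite Q)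
  interpret PJ: prob_space "PiM J P" by (intro prob_space_PiM P)
  interpret QJ: prob_space "PiM J Q" by (intro prob_space_PiM Q)
  have PJQi: "pair_sigma_finite (PiM J P) (Q i)" and QJQi: "pair_sigma_finite (PiM J Q) (Q i)"
    by (standard)+
  have fJ: "integrable (PiM J P) (\<lambda>x. a v + (\<Sum>j\<in>J. f j (x j) v))" if "v \<in> T" for v a
    using that insert.prems P by (intro integrable_PiM_sum) auto
  have gJ: "integrable (PiM J Q) (\<lambda>x. a v + (\<Sum>j\<in>J. g j (x j) v))" if "v \<in> T" for v a
    using that insert.prems Q by (intro integrable_PiM_sum) auto
  have int1: "integrable (PiM J P \<Otimes>\<^sub>M Q i) (\<lambda>(x, z). max_over T (\<lambda>v. a v + (\<Sum>j\<in>J. f j (x j) v) + g i z v))"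
    using fJ insert.prems Q prob_space_PiM[OF P] unfolding case_prod_beta by (intro integrable_max_over integrable_pair_add) auto
  have int2: "integrable (PiM J Q \<Otimes>\<^sub>M Q i) (\<lambda>(x, z). max_over T (\<lambda>v. a v + (\<Sum>j\<in>J. g j (x j) v) + g i z v))"
    using gJ insert.prems Q prob_space_PiM[OF Q] unfolding case_prod_beta by (intro integrable_max_over integrable_pair_add) auto
  have int3: "integrable (PiM J P \<Otimes>\<^sub>M P i) (\<lambda>(x, z). max_over T (\<lambda>v. a v + (\<Sum>j\<in>J. f j (x j) v) + f i z v))"
    using fJ insert.prems P prob_space_PiM[OF P] unfolding case_prod_beta by (intro integrable_max_over integrable_pair_add) auto
  note upd = sum_insert_fun_upd[OF insert.hyps]
  interpret pair_sigma_finite "PiM J P" "P i" by standard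
  have "(\<integral>x. max_over T (\<lambda>v. a v + (\<Sum>j\<in>insert i J. f j (x j) v)) \<partial>PiM (insert i J) P)
      = (\<integral>x. (\<integral>y. max_over T (\<lambda>v. a v + (\<Sum>j\<in>J. f j (x j) v) + f i y v) \<partial>P i) \<partial>PiM J P)"
    using insert.prems P
    by (subst P.product_integral_insert[OF insert.hyps]) (auto simp only: upd intro!: integrable_max_over integrable_PiM_sum)
  also have "\<dots> \<le> (\<integral>x. (\<integral>z. max_over T (\<lambda>v. a v + (\<Sum>j\<in>J. f j (x j) v) + g i z v) \<partial>Q i) \<partial>PiM J P)"
    using integrable_fst'[OF int3] pair_sigma_finite.integrable_fst'[OF PJQi int1] insert.prems(3)
    by (intro integral_mono) auto
  also have "\<dots> = (\<integral>z. (\<integral>x. max_over T (\<lambda>v. a v + (\<Sum>j\<in>J. f j (x j) v) + g i z v) \<partial>PiM J P) \<partial>Q i)"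
    by (rule pair_sigma_finite.Fubini_integral[OF PJQi int1, symmetric])
  also have "\<dots> \<le> (\<integral>z. (\<integral>x. max_over T (\<lambda>v. a v + (\<Sum>j\<in>J. g j (x j) v) + g i z v) \<partial>PiM J Q) \<partial>Q i)"
  proof (rule integral_mono)
    show "integrable (Q i) (\<lambda>z. \<integral>x. max_over T (\<lambda>v. a v + (\<Sum>j\<in>J. f j (x j) v) + g i z v) \<partial>PiM J P)"
      by (rule pair_sigma_finite.integrable_snd[OF PJQi int1])
    show "integrable (Q i) (\<lambda>z. \<integral>x. max_over T (\<lambda>v. a v + (\<Sum>j\<in>J. g j (x j) v) + g i z v) \<partial>PiM J Q)"
      by (rule pair_sigma_finite.integrable_snd[OF QJQi int2])
    fix z
    show "(\<integral>x. max_over T (\<lambda>v. a v + (\<Sum>j\<in>J. f j (x j) v) + g i z v) \<partial>PiM J P)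
      \<le> (\<integral>x. max_over T (\<lambda>v. a v + (\<Sum>j\<in>J. g j (x j) v) + g i z v) \<partial>PiM J Q)"
      using insert.IH[of "\<lambda>v. a v + g i z v"] insert.prems by (simp add: add.assoc add.commute[of "g i z _"])
  qed
  also have "\<dots> = (\<integral>x. (\<integral>z. max_over T (\<lambda>v. a v + (\<Sum>j\<in>J. g j (x j) v) + g i z v) \<partial>Q i) \<partial>PiM J Q)"
    by (rule pair_sigma_finite.Fubini_integral[OF QJQi int2])
  also have "\<dots> = (\<integral>x. max_over T (\<lambda>v. a v + (\<Sum>j\<in>insert i J. g j (x j) v)) \<partial>PiM (insert i J) Q)"
    using insert.prems Q
    by (subst Q.product_integral_insert[OF insert.hyps]) (auto simp only: upd intro!: integrable_max_over integrable_PiM_sum)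
  finally show ?case .
qed

end

section \<open>Sums of independent vectors\<close>

lemma (in prob_space) indep_vars_product_law:
  fixes U :: "'i \<Rightarrow> 'a \<Rightarrow> 'b::topological_space"
  assumes "indep_vars (\<lambda>_. borel) U J" "J \<noteq> {}"
  obtains P where "\<And>i. prob_space (P i)" "\<And>i. sets (P i) = sets borel"
    "\<And>i. i \<in> J \<Longrightarrow> P i = distr M borel (U i)"
    "distr M (PiM J (\<lambda>_. borel)) (\<lambda>\<omega>. \<lambda>i\<in>J. U i \<omega>) = PiM J P"
proof
  \<comment> \<open>Outside \<open>J\<close> any probability measure will do; the law of a constant is one.\<close>
  define P where "P i = distr M borel (if i \<in> J then U i else (\<lambda>_. undefined))" for i
  have rv: "i \<in> J \<Longrightarrow> U i \<in> borel_measurable M" for i using assms by (auto simp: indep_vars_def2)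
  show "prob_space (P i)" for i unfolding P_def using rv by (intro prob_space_distr) auto
  show "sets (P i) = sets borel" for i by (simp add: P_def)
  show P: "P i = distr M borel (U i)" if "i \<in> J" for i using that by (simp add: P_def)
  show "distr M (PiM J (\<lambda>_. borel)) (\<lambda>\<omega>. \<lambda>i\<in>J. U i \<omega>) = PiM J P"
    using indep_vars_iff_distr_eq_PiM'[where I = J and M' = "\<lambda>_. borel" and X = U] assms rv P
    by (simp cong: PiM_cong)
qed

text \<open>
  The preceding comparison in terms of random variables on one space. The families \<open>U\<close> and \<open>V\<close>
  may depend on each other in any way, since only their separate joint laws enter.
\<close>

lemma (in prob_space) expectation_max_over_sum_mono:
  fixes U V :: "'i \<Rightarrow> 'a \<Rightarrow> 'b::topological_space" and f g :: "'i \<Rightarrow> 'b \<Rightarrow> 'v \<Rightarrow> real"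
  assumes T: "finite T" "T \<noteq> {}" and J: "finite J"
    and U: "indep_vars (\<lambda>_. borel) U J" and V: "indep_vars (\<lambda>_. borel) V J"
    and f [measurable]: "\<And>i v. i \<in> J \<Longrightarrow> v \<in> T \<Longrightarrow> (\<lambda>x. f i x v) \<in> borel_measurable borel"
    and g [measurable]: "\<And>i v. i \<in> J \<Longrightarrow> v \<in> T \<Longrightarrow> (\<lambda>x. g i x v) \<in> borel_measurable borel"
    and intf: "\<And>i v. i \<in> J \<Longrightarrow> v \<in> T \<Longrightarrow> integrable M (\<lambda>\<omega>. f i (U i \<omega>) v)"
    and intg: "\<And>i v. i \<in> J \<Longrightarrow> v \<in> T \<Longrightarrow> integrable M (\<lambda>\<omega>. g i (V i \<omega>) v)"
    and le: "\<And>i a. i \<in> J \<Longrightarrow> expectation (\<lambda>\<omega>. max_over T (\<lambda>v. a v + f i (U i \<omega>) v))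
                              \<le> expectation (\<lambda>\<omega>. max_over T (\<lambda>v. a v + g i (V i \<omega>) v))"
  shows "expectation (\<lambda>\<omega>. max_over T (\<lambda>v. a v + (\<Sum>i\<in>J. f i (U i \<omega>) v)))
      \<le> expectation (\<lambda>\<omega>. max_over T (\<lambda>v. a v + (\<Sum>i\<in>J. g i (V i \<omega>) v)))"
proof (cases "J = {}")
  case False
  note meas = borel_measurable_max_over[OF T]
  have rvU [measurable]: "i \<in> J \<Longrightarrow> U i \<in> borel_measurable M" for i using U by (auto simp: indep_vars_def2)
  have rvV [measurable]: "i \<in> J \<Longrightarrow> V i \<in> borel_measurable M" for i using V by (auto simp: indep_vars_def2)
  obtain P where P: "\<And>i. prob_space (P i)" "\<And>i. sets (P i) = sets borel"
    "\<And>i. i \<in> J \<Longrightarrow> P i = distr M borel (U i)"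
    and lawU: "distr M (PiM J (\<lambda>_. borel)) (\<lambda>\<omega>. \<lambda>i\<in>J. U i \<omega>) = PiM J P"
    using indep_vars_product_law[OF U False] by blast
  obtain Q where Q: "\<And>i. prob_space (Q i)" "\<And>i. sets (Q i) = sets borel"
    "\<And>i. i \<in> J \<Longrightarrow> Q i = distr M borel (V i)"
    and lawV: "distr M (PiM J (\<lambda>_. borel)) (\<lambda>\<omega>. \<lambda>i\<in>J. V i \<omega>) = PiM J Q"
    using indep_vars_product_law[OF V False] by blast
  have PU: "(\<integral>x. h x \<partial>P i) = expectation (\<lambda>\<omega>. h (U i \<omega>))"
    if "i \<in> J" "h \<in> borel_measurable borel" for i and h :: "'b \<Rightarrow> real"
    using that P(3) by (simp add: integral_distr)
  have QV: "(\<integral>x. h x \<partial>Q i) = expectation (\<lambda>\<omega>. h (V i \<omega>))"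
    if "i \<in> J" "h \<in> borel_measurable borel" for i and h :: "'b \<Rightarrow> real"
    using that Q(3) by (simp add: integral_distr)
  have "expectation (\<lambda>\<omega>. max_over T (\<lambda>v. a v + (\<Sum>i\<in>J. f i (U i \<omega>) v)))
      = (\<integral>x. max_over T (\<lambda>v. a v + (\<Sum>i\<in>J. f i (x i) v)) \<partial>PiM J P)"
    unfolding lawU[symmetric] by (subst integral_distr) (auto intro!: meas measurable_restrict)
  also have "\<dots> \<le> (\<integral>x. max_over T (\<lambda>v. a v + (\<Sum>i\<in>J. g i (x i) v)) \<partial>PiM J Q)"
  proof (rule expectation_max_over_sum_mono_PiM[OF T J P(1) Q(1)])
    fix i v assume iv: "i \<in> J" "v \<in> T"
    show "integrable (P i) (\<lambda>x. f i x v)" "integrable (Q i) (\<lambda>x. g i x v)"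
      using iv P(3) Q(3) intf intg by (auto simp: integrable_distr_eq)
  next
    fix i a assume i: "i \<in> J"
    show "(\<integral>x. max_over T (\<lambda>v. a v + f i x v) \<partial>P i) \<le> (\<integral>x. max_over T (\<lambda>v. a v + g i x v) \<partial>Q i)"
      using le[OF i, of a] PU[OF i meas[OF borel_measurable_add[OF borel_measurable_const f[OF i]]]]
        QV[OF i meas[OF borel_measurable_add[OF borel_measurable_const g[OF i]]]] by simp
  qed
  also have "\<dots> = expectation (\<lambda>\<omega>. max_over T (\<lambda>v. a v + (\<Sum>i\<in>J. g i (V i \<omega>) v)))"
    unfolding lawV[symmetric] by (subst integral_distr) (auto intro!: meas measurable_restrict)
  finally show ?thesis .
qed simp

lemma (in prob_space) indep_vars_block_sums:
  fixes Y :: "'i \<Rightarrow> 'a \<Rightarrow> 'b::euclidean_space"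
  assumes "indep_vars (\<lambda>_. borel) Y I" "disjoint_family_on B L" "\<And>k. k \<in> L \<Longrightarrow> B k \<subseteq> I"
  shows "indep_vars (\<lambda>_. borel) (\<lambda>k \<omega>. \<Sum>i\<in>B k. Y i \<omega>) L"
proof -
  have "indep_vars (\<lambda>k. PiM (B k) (\<lambda>_. borel)) (\<lambda>k \<omega>. restrict (\<lambda>i. Y i \<omega>) (B k)) L"
    using assms by (intro indep_vars_restrict[where I = I]) auto
  then have "indep_vars (\<lambda>_. borel) (\<lambda>k \<omega>. \<Sum>i\<in>B k. restrict (\<lambda>i. Y i \<omega>) (B k) i) L"
    by (rule indep_vars_compose2) (auto intro!: borel_measurable_sum)
  then show ?thesis by simp
qed

section \<open>The bounded differences inequality\<close>

text \<open>
  Averaging \<open>F\<close> over the coordinate \<open>i\<close> gives a function \<open>G\<close> of the other coordinates that again has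
  bounded differences. For fixed other coordinates, \<open>F\<close> ranges over an interval of length \<open>c i\<close>, so
  Hoeffding's lemma bounds the moment generating function of \<open>F - G\<close>; that of \<open>G\<close> is bounded by
  induction.
\<close>

lemma (in product_prob_space) mgf_bounded_differences:
  fixes F :: "('i \<Rightarrow> 'a) \<Rightarrow> real" and c :: "'i \<Rightarrow> real"
  assumes "finite J" and "l > 0"
    and "F \<in> borel_measurable (PiM J M)"
    and "\<And>x. x \<in> space (PiM J M) \<Longrightarrow> \<bar>F x\<bar> \<le> C"
    and "\<And>x j y. x \<in> space (PiM J M) \<Longrightarrow> j \<in> J \<Longrightarrow> y \<in> space (M j) \<Longrightarrow> \<bar>F (x(j := y)) - F x\<bar> \<le> c j"
  shows "(\<integral>\<^sup>+x. exp (l * (F x - (\<integral>x. F x \<partial>PiM J M))) \<partial>PiM J M)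
           \<le> ennreal (exp (l\<^sup>2 * (\<Sum>j\<in>J. (c j)\<^sup>2) / 8))"
  using assms(1,3-)
proof (induction J arbitrary: F rule: finite_induct)
  case empty
  show ?case
    by (simp add: PiM_empty lebesgue_integral_count_space_finite nn_integral_count_space_finite)
next
  case (insert i J)
  note [measurable] = insert.prems(1)
  interpret PJ: prob_space "PiM J M" by (intro prob_space_PiM prob_space)
  interpret PI: prob_space "PiM (insert i J) M" by (intro prob_space_PiM prob_space)
  have upd: "x(i := y) \<in> space (PiM (insert i J) M)"
    if "x \<in> space (PiM J M)" "y \<in> space (M i)" for x y
    using that by (auto simp: space_PiM PiE_def extensional_def)
  have meas_upd [measurable]: "(\<lambda>y. F (x(i := y))) \<in> borel_measurable (M i)"
    if "x \<in> space (PiM J M)" for x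
    using measurable_compose[OF measurable_component_update insert.prems(1), OF that] insert.hyps by (simp add: fun_upd_def)
  have integrable_upd: "integrable (M i) (\<lambda>y. F (x(i := y)))" if "x \<in> space (PiM J M)" for x
    using that upd insert.prems(2) by (intro M.integrable_const_bound[where B = C]) auto
  define G where "G x = (\<integral>y. F (x(i := y)) \<partial>M i)" for x
  have meas_G [measurable]: "G \<in> borel_measurable (PiM J M)"
  proof -
    have "(\<lambda>z. F ((fst z)(i := snd z))) \<in> borel_measurable (PiM J M \<Otimes>\<^sub>M M i)"
      using measurable_compose[OF measurable_add_dim insert.prems(1)] by (simp add: case_prod_beta)
    then show ?thesis
      unfolding G_def by (intro M.borel_measurable_lebesgue_integral) (simp add: case_prod_beta)
  qed
  have bound_G: "\<bar>G x\<bar> \<le> C" if "x \<in> space (PiM J M)" for x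
  proof -
    have "\<bar>G x\<bar> \<le> (\<integral>y. \<bar>F (x(i := y))\<bar> \<partial>M i)" unfolding G_def by (rule integral_abs_bound)
    also have "\<dots> \<le> (\<integral>y. C \<partial>M i)"
      using that upd insert.prems(2) integrable_upd
      by (intro integral_mono) auto
    finally show ?thesis by (simp add: M.prob_space)
  qed
  have diff_G: "\<bar>G (x(j := y)) - G x\<bar> \<le> c j"
    if x: "x \<in> space (PiM J M)" and j: "j \<in> J" and y: "y \<in> space (M j)" for x j y
  proof -
    have ne: "i \<noteq> j" using j insert.hyps by auto
    have xy: "x(j := y) \<in> space (PiM J M)"
      using x j y by (auto simp: space_PiM PiE_def extensional_def)
    have "\<bar>G (x(j := y)) - G x\<bar> = \<bar>\<integral>z. F (x(j := y, i := z)) - F (x(i := z)) \<partial>M i\<bar>"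
      unfolding G_def using integrable_upd[OF x] integrable_upd[OF xy] by simp
    also have "\<dots> \<le> (\<integral>z. \<bar>F (x(j := y, i := z)) - F (x(i := z))\<bar> \<partial>M i)" by (rule integral_abs_bound)
    also have "\<dots> \<le> (\<integral>z. c j \<partial>M i)"
    proof (rule integral_mono)
      show "integrable (M i) (\<lambda>z. \<bar>F (x(j := y, i := z)) - F (x(i := z))\<bar>)"
        using integrable_upd[OF x] integrable_upd[OF xy] by auto
      fix z assume z: "z \<in> space (M i)"
      show "\<bar>F (x(j := y, i := z)) - F (x(i := z))\<bar> \<le> c j"
        unfolding fun_upd_twist[OF ne[symmetric]] using j y by (intro insert.prems(3) upd x z) auto
    qed auto
    finally show ?thesis by (simp add: M.prob_space)
  qed
  have integrable_F: "integrable (PiM (insert i J) M) F"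
    using insert.prems(2) by (intro PI.integrable_const_bound[where B = C]) auto
  have mean: "(\<integral>x. F x \<partial>PiM (insert i J) M) = (\<integral>x. G x \<partial>PiM J M)"
    unfolding G_def using insert.hyps integrable_F by (rule product_integral_insert)
  define m where "m = (\<integral>x. G x \<partial>PiM J M)"
  have inner: "(\<integral>\<^sup>+y. exp (l * (F (x(i := y)) - G x)) \<partial>M i) \<le> ennreal (exp (l\<^sup>2 * (c i)\<^sup>2 / 8))"
    if x: "x \<in> space (PiM J M)" for x
  proof -
    define a where "a = (INF y\<in>space (M i). F (x(i := y)))"
    have bdd: "bdd_below ((\<lambda>y. F (x(i := y))) ` space (M i))"
      using upd[OF x] insert.prems(2) by (intro bdd_belowI2[where m = "-C"]) (metis abs_le_D2 minus_le_iff)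
    interpret interval_bounded_random_variable "M i" "\<lambda>y. F (x(i := y))" a "a + c i"
    proof (unfold_locales, use x in measurable, intro AE_I2)
      fix y assume y: "y \<in> space (M i)"
      have "F (x(i := y)) - c i \<le> a" unfolding a_def
      proof (rule cINF_greatest)
        fix z assume z: "z \<in> space (M i)"
        have "\<bar>F (x(i := z)) - F (x(i := y))\<bar> \<le> c i"
          using insert.prems(3)[OF upd[OF x y] _ z] unfolding fun_upd_upd by blast
        then show "F (x(i := y)) - c i \<le> F (x(i := z))" by linarith
      qed (use y in auto)
      moreover have "a \<le> F (x(i := y))"
        unfolding a_def by (intro cINF_lower bdd y)
      ultimately show "F (x(i := y)) \<in> {a..a + c i}" by simp
    qed
    show ?thesis
      using Hoeffdings_lemma_nn_integral[OF \<open>l > 0\<close>] by (simp add: G_def)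
  qed
  have "(\<integral>\<^sup>+x. exp (l * (F x - m)) \<partial>PiM (insert i J) M)
      = (\<integral>\<^sup>+x. (\<integral>\<^sup>+y. exp (l * (F (x(i := y)) - m)) \<partial>M i) \<partial>PiM J M)"
    using insert.hyps by (intro product_nn_integral_insert) auto
  also have "\<dots> = (\<integral>\<^sup>+x. ennreal (exp (l * (G x - m))) * (\<integral>\<^sup>+y. exp (l * (F (x(i := y)) - G x)) \<partial>M i) \<partial>PiM J M)"
    by (intro nn_integral_cong, subst nn_integral_cmult[symmetric])
       (auto intro!: nn_integral_cong simp: ennreal_mult[symmetric] exp_add[symmetric] algebra_simps)
  also have "\<dots> \<le> (\<integral>\<^sup>+x. ennreal (exp (l * (G x - m))) * ennreal (exp (l\<^sup>2 * (c i)\<^sup>2 / 8)) \<partial>PiM J M)"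
    by (intro nn_integral_mono mult_left_mono inner) auto
  also have "\<dots> = (\<integral>\<^sup>+x. exp (l * (G x - m)) \<partial>PiM J M) * ennreal (exp (l\<^sup>2 * (c i)\<^sup>2 / 8))"
    by (intro nn_integral_multc) measurable
  also have "\<dots> \<le> ennreal (exp (l\<^sup>2 * (\<Sum>j\<in>J. (c j)\<^sup>2) / 8)) * ennreal (exp (l\<^sup>2 * (c i)\<^sup>2 / 8))"
    unfolding m_def by (intro mult_right_mono insert.IH meas_G bound_G diff_G) auto
  also have "\<dots> = ennreal (exp (l\<^sup>2 * (\<Sum>j\<in>insert i J. (c j)\<^sup>2) / 8))"
    using insert.hyps by (simp add: ennreal_mult[symmetric] exp_add[symmetric] distrib_left add_divide_distrib add.commute)
  finally show ?case by (simp add: mean m_def)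
qed

text \<open>
  McDiarmid's inequality: Markov's inequality for \<open>exp (l * F)\<close> with the optimal \<open>l\<close>.
\<close>

theorem (in product_prob_space) bounded_differences_ineq:
  fixes F :: "('i \<Rightarrow> 'a) \<Rightarrow> real" and c :: "'i \<Rightarrow> real"
  assumes J: "finite J" and F: "F \<in> borel_measurable (PiM J M)"
    and bd: "\<And>x. x \<in> space (PiM J M) \<Longrightarrow> \<bar>F x\<bar> \<le> C"
    and diff: "\<And>x j y. x \<in> space (PiM J M) \<Longrightarrow> j \<in> J \<Longrightarrow> y \<in> space (M j) \<Longrightarrow> \<bar>F (x(j := y)) - F x\<bar> \<le> c j"
    and t: "t > 0" and d: "0 < (\<Sum>j\<in>J. (c j)\<^sup>2)"
  shows "measure (PiM J M) {x\<in>space (PiM J M). F x - (\<integral>x. F x \<partial>PiM J M) \<ge> t}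
           \<le> exp (- 2 * t\<^sup>2 / (\<Sum>j\<in>J. (c j)\<^sup>2))"
proof -
  define s where "s = (\<Sum>j\<in>J. (c j)\<^sup>2)"
  \<comment> \<open>The minimizer of \<open>l\<^sup>2 * s / 8 - l * t\<close>.\<close>
  define l where "l = 4 * t / s"
  have s: "s > 0" and l: "l > 0" using t d by (auto simp: s_def l_def)
  interpret PJ: prob_space "PiM J M" by (intro prob_space_PiM prob_space)
  note [measurable] = F
  have "ennreal (measure (PiM J M) {x\<in>space (PiM J M). F x - (\<integral>x. F x \<partial>PiM J M) \<ge> t})
      = emeasure (PiM J M) {x\<in>space (PiM J M). F x - (\<integral>x. F x \<partial>PiM J M) \<ge> t}"
    by (simp add: PJ.emeasure_eq_measure)
  also have "\<dots> \<le> ennreal (exp (- l * t)) *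
      (\<integral>\<^sup>+x\<in>space (PiM J M). exp (l * (F x - (\<integral>x. F x \<partial>PiM J M))) \<partial>PiM J M)"
    by (intro Chernoff_ineq_nn_integral_ge l) auto
  also have "(\<integral>\<^sup>+x\<in>space (PiM J M). exp (l * (F x - (\<integral>x. F x \<partial>PiM J M))) \<partial>PiM J M)
      = (\<integral>\<^sup>+x. exp (l * (F x - (\<integral>x. F x \<partial>PiM J M))) \<partial>PiM J M)"
    by (intro nn_integral_cong) auto
  also have "ennreal (exp (- l * t)) * \<dots> \<le> ennreal (exp (- l * t)) * ennreal (exp (l\<^sup>2 * s / 8))"
    unfolding s_def using mgf_bounded_differences[OF J l F bd diff] by (rule mult_left_mono) simp_all
  also have "\<dots> = ennreal (exp (l\<^sup>2 * s / 8 - l * t))"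
    by (simp add: ennreal_mult[symmetric] exp_add[symmetric])
  also have "l\<^sup>2 * s / 8 - l * t = - 2 * t\<^sup>2 / s"
    using s by (simp add: l_def field_simps power2_eq_square)
  finally show ?thesis by (simp add: s_def)
qed

lemma (in prob_space) bounded_differences_ineq_indep_vars:
  fixes U :: "'i \<Rightarrow> 'a \<Rightarrow> 'b::topological_space" and F :: "('i \<Rightarrow> 'b) \<Rightarrow> real"
  assumes J: "finite J" "J \<noteq> {}" and U: "indep_vars (\<lambda>_. borel) U J"
    and F: "F \<in> borel_measurable (PiM J (\<lambda>_. borel))"
    and bd: "\<And>x. \<bar>F x\<bar> \<le> C"
    and diff: "\<And>x j y. j \<in> J \<Longrightarrow> \<bar>F (x(j := y)) - F x\<bar> \<le> c j"
    and t: "t > 0" and d: "0 < (\<Sum>j\<in>J. (c j)\<^sup>2)"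
  shows "prob {\<omega>\<in>space M. expectation (\<lambda>\<omega>. F (\<lambda>j\<in>J. U j \<omega>)) + t \<le> F (\<lambda>j\<in>J. U j \<omega>)}
           \<le> exp (- 2 * t\<^sup>2 / (\<Sum>j\<in>J. (c j)\<^sup>2))"
proof -
  let ?U = "\<lambda>\<omega>. \<lambda>j\<in>J. U j \<omega>" and ?N = "PiM J (\<lambda>_. borel :: 'b measure)"
  obtain P where P: "\<And>i. prob_space (P i)" "\<And>i. sets (P i) = sets borel"
    and law: "distr M ?N ?U = PiM J P"
    using indep_vars_product_law[OF U J(2)] by metis
  have U_meas [measurable]: "?U \<in> measurable M ?N"
    using U by (intro measurable_restrict) (auto simp: indep_vars_def2)
  have sets_P: "sets (PiM J P) = sets ?N" using P(2) by (intro sets_PiM_cong) auto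
  note [measurable] = F
  interpret P: product_prob_space P J
    by (intro product_prob_space.intro product_sigma_finite.intro product_prob_space_axioms.intro
        prob_space_imp_sigma_finite P)
  have F': "F \<in> borel_measurable (PiM J P)"
    using F measurable_cong_sets[OF sets_P] by blast
  have E: "(\<integral>x. F x \<partial>PiM J P) = expectation (\<lambda>\<omega>. F (?U \<omega>))"
    unfolding law[symmetric] by (rule integral_distr) measurable
  have "prob {\<omega>\<in>space M. expectation (\<lambda>\<omega>. F (?U \<omega>)) + t \<le> F (?U \<omega>)}
      = measure (distr M ?N ?U) {x\<in>space (distr M ?N ?U). F x - (\<integral>x. F x \<partial>PiM J P) \<ge> t}"
  proof -
    have "{x \<in> space ?N. t \<le> F x - expectation (\<lambda>\<omega>. F (?U \<omega>))} \<in> sets ?N" by measurable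
    then show ?thesis
      unfolding E by (subst measure_distr)
        (auto intro!: arg_cong[where f = prob] simp: space_PiM)
  qed
  also have "\<dots> \<le> exp (- 2 * t\<^sup>2 / (\<Sum>j\<in>J. (c j)\<^sup>2))"
    unfolding law using J(1) F' bd diff t d by (rule P.bounded_differences_ineq)
  finally show ?thesis .
qed

section \<open>Symmetrization and concentration of ramp sums over blocks\<close>

text \<open>
  A Lipschitz lower bound of the indicator of \<open>{\<rho> / 2 <..}\<close> and upper bound of the indicator of
  \<open>{\<rho>..}\<close>, for positive \<open>\<rho>\<close>.
\<close>

definition ramp :: "real \<Rightarrow> real \<Rightarrow> real" where
  "ramp \<rho> t = max 0 (min 1 (2 * t / \<rho> - 1))"

lemma ramp_bounds: "0 \<le> ramp \<rho> t" "ramp \<rho> t \<le> 1"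
  by (auto simp: ramp_def)

lemma ramp_lipschitz:
  assumes "0 < \<rho>"
  shows "\<bar>ramp \<rho> s - ramp \<rho> t\<bar> \<le> \<bar>2 / \<rho> * s - 2 / \<rho> * t\<bar>"
  by (auto simp: ramp_def max_def min_def)

text \<open>
  This is \<open>2 u - 1 \<le> u\<^sup>2\<close> for \<open>u = t / \<rho>\<close>. It is sharper by a factor \<open>4\<close> than Chebyshev's
  inequality at the threshold \<open>\<rho> / 2\<close>, and the constants of the error bound depend on that gain.
\<close>

lemma ramp_le_square: "ramp \<rho> t \<le> (t / \<rho>)\<^sup>2"
proof -
  have "0 \<le> (t / \<rho> - 1)\<^sup>2" by simp
  then have "2 * t / \<rho> - 1 \<le> (t / \<rho>)\<^sup>2" by (simp add: power2_eq_square algebra_simps)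
  then show ?thesis by (simp add: ramp_def)
qed

lemma ramp_eq_1: "0 < \<rho> \<Longrightarrow> \<rho> \<le> t \<Longrightarrow> ramp \<rho> t = 1"
  by (simp add: ramp_def field_simps)

lemma ramp_antimono:
  assumes "0 < \<rho>" "\<rho> \<le> \<rho>'"
  shows "ramp \<rho>' t \<le> ramp \<rho> t"
proof (cases "0 \<le> t")
  case True
  then have "2 * t / \<rho>' \<le> 2 * t / \<rho>" using assms by (intro divide_left_mono) auto
  then show ?thesis by (simp add: ramp_def)
next
  case False
  then have "2 * t / \<rho>' < 0" using assms by (simp add: divide_less_0_iff)
  then show ?thesis by (simp add: ramp_def)
qed

lemma continuous_on_ramp [continuous_intros]:
  "continuous_on A f \<Longrightarrow> continuous_on A (\<lambda>x. ramp \<rho> (f x))"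
  unfolding ramp_def divide_inverse by (intro continuous_intros)

lemma borel_measurable_ramp [measurable]: "ramp \<rho> \<in> borel_measurable borel"
  by (intro borel_measurable_continuous_onI continuous_on_ramp continuous_on_id)

text \<open>
  \<open>Y\<close> is a centred sample and the law of \<open>Z i\<close> is the even mixture of the laws of \<open>Y i\<close> and
  \<open>- Y i\<close>, as for \<open>Z i = \<epsilon> i *\<^sub>R Y i\<close> with independent Rademacher signs. Only these marginal laws
  and the independence within each family are recorded, because the comparison of expected
  maxima depends on nothing else.
\<close>

locale symmetrized_sample = prob_space M
  for M :: "'a measure" +
  fixes I :: "'i set" and Y Z :: "'i \<Rightarrow> 'a \<Rightarrow> 'b::euclidean_space"
  assumes I: "finite I"
    and Y: "indep_vars (\<lambda>_. borel) Y I" and Z: "indep_vars (\<lambda>_. borel) Z I"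
    and int_Y: "\<And>i. i \<in> I \<Longrightarrow> integrable M (Y i)"
    and mean_Y: "\<And>i. i \<in> I \<Longrightarrow> expectation (Y i) = 0"
    and int_Z: "\<And>i. i \<in> I \<Longrightarrow> integrable M (Z i)"
    and symm: "\<And>i h. i \<in> I \<Longrightarrow> h \<in> borel_measurable borel \<Longrightarrow>
      integrable M (\<lambda>\<omega>. h (Y i \<omega>)) \<Longrightarrow> integrable M (\<lambda>\<omega>. h (- Y i \<omega>)) \<Longrightarrow>
      expectation (\<lambda>\<omega>. h (Z i \<omega>) :: real)
        = (expectation (\<lambda>\<omega>. h (Y i \<omega>)) + expectation (\<lambda>\<omega>. h (- Y i \<omega>))) / 2"
begin

lemma rv_Y [measurable]: "i \<in> I \<Longrightarrow> Y i \<in> borel_measurable M"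
  using Y by (auto simp: indep_vars_def2)

lemma rv_Z [measurable]: "i \<in> I \<Longrightarrow> Z i \<in> borel_measurable M"
  using Z by (auto simp: indep_vars_def2)

context
  fixes T :: "'b set"
  assumes T: "finite T" "T \<noteq> {}"
begin

lemma expectation_max_summand_le_symmetrized:
  assumes i: "i \<in> I"
  shows "expectation (\<lambda>\<omega>. max_over T (\<lambda>v. a v + c * (Y i \<omega> \<bullet> v)))
    \<le> expectation (\<lambda>\<omega>. max_over T (\<lambda>v. a v + 2 * \<bar>c\<bar> * (Z i \<omega> \<bullet> v)))"
proof -
  define h where "h y = max_over T (\<lambda>v. a v + 2 * \<bar>c\<bar> * (y \<bullet> v))" for y :: 'b
  have h: "h \<in> borel_measurable borel"
    unfolding h_def by (intro borel_measurable_max_over T) measurable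
  have inth: "integrable M (\<lambda>\<omega>. h (Y i \<omega>))" "integrable M (\<lambda>\<omega>. h (- Y i \<omega>))"
    using int_Y[OF i] unfolding h_def by (auto intro!: integrable_max_over T)
  have mean: "expectation (\<lambda>\<omega>. c * (Y i \<omega> \<bullet> v)) = 0" for v
    using int_Y[OF i] mean_Y[OF i] by simp
  have "expectation (\<lambda>\<omega>. max_over T (\<lambda>v. a v + (c * (Y i \<omega> \<bullet> v) - expectation (\<lambda>\<omega>. c * (Y i \<omega> \<bullet> v)))))
    \<le> (expectation (\<lambda>\<omega>. max_over T (\<lambda>v. a v + 2 * (c * (Y i \<omega> \<bullet> v))))
       + expectation (\<lambda>\<omega>. max_over T (\<lambda>v. a v - 2 * (c * (Y i \<omega> \<bullet> v))))) / 2"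
    using int_Y[OF i] by (intro expectation_max_symmetrize T prob_space_axioms) auto
  also have "\<dots> = (expectation (\<lambda>\<omega>. h (Y i \<omega>)) + expectation (\<lambda>\<omega>. h (- Y i \<omega>))) / 2"
    by (cases "c \<ge> 0") (simp_all add: h_def mult.assoc)
  also have "\<dots> = expectation (\<lambda>\<omega>. h (Z i \<omega>))"
    using symm[OF i h inth] by simp
  finally show ?thesis unfolding mean h_def diff_zero .
qed

text \<open>
  The bound depends on \<open>c\<close> only through \<open>\<bar>c\<bar>\<close>, because the laws of the \<open>Z i\<close> are symmetric. This
  absorbs the sign that a whole block carries after symmetrization over blocks.
\<close>

lemma expectation_max_sum_le_symmetrized:
  assumes A: "A \<subseteq> I"
  shows "expectation (\<lambda>\<omega>. max_over T (\<lambda>v. a v + (\<Sum>i\<in>A. c * (Y i \<omega> \<bullet> v))))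
    \<le> expectation (\<lambda>\<omega>. max_over T (\<lambda>v. a v + (\<Sum>i\<in>A. 2 * \<bar>c\<bar> * (Z i \<omega> \<bullet> v))))"
proof (rule expectation_max_over_sum_mono[OF T])
  show "finite A" using A I finite_subset by blast
  show "indep_vars (\<lambda>_. borel) Y A" "indep_vars (\<lambda>_. borel) Z A"
    using indep_vars_subset[OF _ A] Y Z by auto
qed (use A int_Y int_Z expectation_max_summand_le_symmetrized in auto)

text \<open>
  One block as a summand: symmetrizing it costs a factor \<open>2\<close>, contraction replaces \<open>\<psi>\<close> by
  multiplication with \<open>L\<close>, and for either sign of the block the observations inside it are
  symmetrized at the cost of another factor \<open>2\<close>.
\<close>

lemma expectation_max_block_le_symmetrized:
  assumes A: "A \<subseteq> I" and L: "0 \<le> L" and \<psi>: "\<And>s t. \<bar>\<psi> s - \<psi> t\<bar> \<le> \<bar>L * s - L * t\<bar>"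
    and [measurable]: "\<psi> \<in> borel_measurable borel" and bd: "\<And>s. \<bar>\<psi> s\<bar> \<le> C"
  shows "expectation (\<lambda>\<omega>. max_over T (\<lambda>v. a v + (\<psi> ((\<Sum>i\<in>A. Y i \<omega>) \<bullet> v)
            - expectation (\<lambda>\<omega>. \<psi> ((\<Sum>i\<in>A. Y i \<omega>) \<bullet> v)))))
    \<le> expectation (\<lambda>\<omega>. max_over T (\<lambda>v. a v + 4 * L * ((\<Sum>i\<in>A. Z i \<omega>) \<bullet> v)))"
proof -
  define W where "W \<omega> = (\<Sum>i\<in>A. Y i \<omega>)" for \<omega>
  have [measurable]: "W \<in> borel_measurable M" unfolding W_def using A by (intro borel_measurable_sum) auto
  have int_W: "integrable M W" unfolding W_def using A int_Y by auto
  have int_\<psi>: "integrable M (\<lambda>\<omega>. \<psi> (W \<omega> \<bullet> v))" for v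
    using bd by (intro integrable_const_bound[where B = C]) auto
  have signed: "expectation (\<lambda>\<omega>. max_over T (\<lambda>v. a v + c * (W \<omega> \<bullet> v)))
      \<le> expectation (\<lambda>\<omega>. max_over T (\<lambda>v. a v + 4 * L * ((\<Sum>i\<in>A. Z i \<omega>) \<bullet> v)))" if "\<bar>c\<bar> = 2 * L" for c
    using expectation_max_sum_le_symmetrized[OF A, of a c] that
    by (simp add: W_def inner_sum_left sum_distrib_left)
  have "expectation (\<lambda>\<omega>. max_over T (\<lambda>v. a v + (\<psi> (W \<omega> \<bullet> v) - expectation (\<lambda>\<omega>. \<psi> (W \<omega> \<bullet> v)))))
    \<le> (expectation (\<lambda>\<omega>. max_over T (\<lambda>v. a v + 2 * \<psi> (W \<omega> \<bullet> v)))
       + expectation (\<lambda>\<omega>. max_over T (\<lambda>v. a v - 2 * \<psi> (W \<omega> \<bullet> v)))) / 2"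
    using int_\<psi> by (intro expectation_max_symmetrize T prob_space_axioms) auto
  also have "\<dots> = expectation (\<lambda>\<omega>. max_over T (\<lambda>v. a v + 2 * \<psi> (W \<omega> \<bullet> v)) + max_over T (\<lambda>v. a v - 2 * \<psi> (W \<omega> \<bullet> v))) / 2"
    using int_\<psi> by (subst Bochner_Integration.integral_add) (auto intro!: integrable_max_over T)
  also have "\<dots> \<le> expectation (\<lambda>\<omega>. max_over T (\<lambda>v. a v + 2 * L * (W \<omega> \<bullet> v)) + max_over T (\<lambda>v. a v - 2 * L * (W \<omega> \<bullet> v))) / 2"
  proof (intro divide_right_mono integral_mono)
    fix \<omega>
    show "max_over T (\<lambda>v. a v + 2 * \<psi> (W \<omega> \<bullet> v)) + max_over T (\<lambda>v. a v - 2 * \<psi> (W \<omega> \<bullet> v))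
       \<le> max_over T (\<lambda>v. a v + 2 * L * (W \<omega> \<bullet> v)) + max_over T (\<lambda>v. a v - 2 * L * (W \<omega> \<bullet> v))"
    proof (rule max_over_contraction[OF T])
      fix v w
      show "\<bar>2 * \<psi> (W \<omega> \<bullet> v) - 2 * \<psi> (W \<omega> \<bullet> w)\<bar> \<le> \<bar>2 * L * (W \<omega> \<bullet> v) - 2 * L * (W \<omega> \<bullet> w)\<bar>"
        using \<psi>[of "W \<omega> \<bullet> v" "W \<omega> \<bullet> w"] by linarith
    qed
  qed (use int_\<psi> int_W in \<open>auto intro!: integrable_max_over T\<close>)
  also have "\<dots> = (expectation (\<lambda>\<omega>. max_over T (\<lambda>v. a v + (2 * L) * (W \<omega> \<bullet> v)))
      + expectation (\<lambda>\<omega>. max_over T (\<lambda>v. a v + (- 2 * L) * (W \<omega> \<bullet> v)))) / 2"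
    using int_W by (subst Bochner_Integration.integral_add) (auto intro!: integrable_max_over T)
  also have "\<dots> \<le> expectation (\<lambda>\<omega>. max_over T (\<lambda>v. a v + 4 * L * ((\<Sum>i\<in>A. Z i \<omega>) \<bullet> v)))"
    using signed[of "2 * L"] signed[of "- 2 * L"] L by simp
  finally show ?thesis by (simp add: W_def)
qed

lemma expectation_max_blocks_le_symmetrized:
  assumes fin: "finite J" and B: "disjoint_family_on B J" "(\<Union>k\<in>J. B k) = I"
    and L: "0 \<le> L" and \<psi>: "\<And>s t. \<bar>\<psi> s - \<psi> t\<bar> \<le> \<bar>L * s - L * t\<bar>"
    and [measurable]: "\<psi> \<in> borel_measurable borel" and bd: "\<And>s. \<bar>\<psi> s\<bar> \<le> C"
  shows "expectation (\<lambda>\<omega>. max_over T (\<lambda>v. \<Sum>k\<in>J. \<psi> ((\<Sum>i\<in>B k. Y i \<omega>) \<bullet> v)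
            - expectation (\<lambda>\<omega>. \<psi> ((\<Sum>i\<in>B k. Y i \<omega>) \<bullet> v))))
    \<le> 4 * L * expectation (\<lambda>\<omega>. max_over T (\<lambda>v. (\<Sum>i\<in>I. Z i \<omega>) \<bullet> v))"
proof -
  have sub: "B k \<subseteq> I" if "k \<in> J" for k using that B by auto
  have finB: "finite (B k)" if "k \<in> J" for k using sub[OF that] I finite_subset by blast
  have [measurable]: "(\<lambda>\<omega>. \<Sum>i\<in>B k. Y i \<omega>) \<in> borel_measurable M" if "k \<in> J" for k
    using sub[OF that] by (intro borel_measurable_sum) auto
  have int_\<psi>: "integrable M (\<lambda>\<omega>. \<psi> ((\<Sum>i\<in>B k. Y i \<omega>) \<bullet> v))" if "k \<in> J" for k v
    using bd that by (intro integrable_const_bound[where B = C]) auto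
  have int_ZB: "integrable M (\<lambda>\<omega>. 4 * L * ((\<Sum>i\<in>B k. Z i \<omega>) \<bullet> v))" if "k \<in> J" for k v
    using sub[OF that] int_Z
    by (intro integrable_mult_right integrable_inner_left Bochner_Integration.integrable_sum) auto
  have "expectation (\<lambda>\<omega>. max_over T (\<lambda>v. 0 + (\<Sum>k\<in>J. \<psi> ((\<Sum>i\<in>B k. Y i \<omega>) \<bullet> v)
            - expectation (\<lambda>\<omega>. \<psi> ((\<Sum>i\<in>B k. Y i \<omega>) \<bullet> v)))))
    \<le> expectation (\<lambda>\<omega>. max_over T (\<lambda>v. 0 + (\<Sum>k\<in>J. 4 * L * ((\<Sum>i\<in>B k. Z i \<omega>) \<bullet> v))))"
  proof (rule expectation_max_over_sum_mono[OF T fin,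
        where f = "\<lambda>k y v. \<psi> (y \<bullet> v) - expectation (\<lambda>\<omega>. \<psi> ((\<Sum>i\<in>B k. Y i \<omega>) \<bullet> v))"
          and g = "\<lambda>k z v. 4 * L * (z \<bullet> v)"])
    show "indep_vars (\<lambda>_. borel) (\<lambda>k \<omega>. \<Sum>i\<in>B k. Y i \<omega>) J" "indep_vars (\<lambda>_. borel) (\<lambda>k \<omega>. \<Sum>i\<in>B k. Z i \<omega>) J"
      using indep_vars_block_sums B(1) sub Y Z by blast+
  next
    fix k a assume "k \<in> J"
    then show "expectation (\<lambda>\<omega>. max_over T (\<lambda>v. a v + (\<psi> ((\<Sum>i\<in>B k. Y i \<omega>) \<bullet> v)
            - expectation (\<lambda>\<omega>. \<psi> ((\<Sum>i\<in>B k. Y i \<omega>) \<bullet> v)))))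
      \<le> expectation (\<lambda>\<omega>. max_over T (\<lambda>v. a v + 4 * L * ((\<Sum>i\<in>B k. Z i \<omega>) \<bullet> v)))"
      using sub L \<psi> bd by (intro expectation_max_block_le_symmetrized[where C = C]) auto
  qed (use int_\<psi> int_ZB in auto)
  also have "(\<lambda>\<omega>. max_over T (\<lambda>v. 0 + (\<Sum>k\<in>J. 4 * L * ((\<Sum>i\<in>B k. Z i \<omega>) \<bullet> v))))
      = (\<lambda>\<omega>. 4 * L * max_over T (\<lambda>v. (\<Sum>i\<in>I. Z i \<omega>) \<bullet> v))"
  proof
    fix \<omega>
    have "(\<Sum>i\<in>I. Z i \<omega>) = (\<Sum>k\<in>J. \<Sum>i\<in>B k. Z i \<omega>)"
      unfolding B(2)[symmetric] using fin finB B(1)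
      by (intro sum.UNION_disjoint) (auto simp: disjoint_family_on_def)
    then show "max_over T (\<lambda>v. 0 + (\<Sum>k\<in>J. 4 * L * ((\<Sum>i\<in>B k. Z i \<omega>) \<bullet> v)))
      = 4 * L * max_over T (\<lambda>v. (\<Sum>i\<in>I. Z i \<omega>) \<bullet> v)"
      using L by (simp add: max_over_scale[OF T, symmetric] inner_sum_left sum_distrib_left)
  qed
  finally show ?thesis by simp
qed

text \<open>
  The three estimates add up as follows: the means of the ramps contribute at most \<open>K / 64\<close>, the
  expected fluctuation at most \<open>K / 8\<close> and the deviation from the expectation \<open>K / 32\<close>, where
  \<open>K = card J\<close>. The total \<open>11 K / 64\<close> is below \<open>3 K / 16\<close>.
\<close>

lemma prob_few_large_blocks:
  fixes \<rho> :: real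
  assumes fin: "finite J" "J \<noteq> {}" and B: "disjoint_family_on B J" "(\<Union>k\<in>J. B k) = I" and \<rho>: "0 < \<rho>"
    and sq: "\<And>k v. k \<in> J \<Longrightarrow> v \<in> T \<Longrightarrow> integrable M (\<lambda>\<omega>. ((\<Sum>i\<in>B k. Y i \<omega>) \<bullet> v)\<^sup>2)"
    and var: "\<And>k v. k \<in> J \<Longrightarrow> v \<in> T \<Longrightarrow> 64 * expectation (\<lambda>\<omega>. ((\<Sum>i\<in>B k. Y i \<omega>) \<bullet> v)\<^sup>2) \<le> \<rho>\<^sup>2"
    and rad: "64 * expectation (\<lambda>\<omega>. max_over T (\<lambda>v. (\<Sum>i\<in>I. Z i \<omega>) \<bullet> v)) \<le> \<rho> * card J"
  shows "{\<omega>\<in>space M. \<forall>v\<in>T. (\<Sum>k\<in>J. ramp \<rho> ((\<Sum>i\<in>B k. Y i \<omega>) \<bullet> v)) \<le> 3 * card J / 16} \<in> events"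
    and "1 - exp (- real (card J) / 512)
      \<le> prob {\<omega>\<in>space M. \<forall>v\<in>T. (\<Sum>k\<in>J. ramp \<rho> ((\<Sum>i\<in>B k. Y i \<omega>) \<bullet> v)) \<le> 3 * card J / 16}"
proof -
  define K where "K = real (card J)"
  have K: "K > 0" using fin by (simp add: K_def card_gt_0_iff)
  have sub: "B k \<subseteq> I" if "k \<in> J" for k using that B by auto
  define W where "W k \<omega> = (\<Sum>i\<in>B k. Y i \<omega>)" for k \<omega>
  have W_rv [measurable]: "W k \<in> borel_measurable M" if "k \<in> J" for k
    unfolding W_def using sub[OF that] by (intro borel_measurable_sum) auto
  have W_ind: "indep_vars (\<lambda>_. borel) W J"
    unfolding W_def using indep_vars_block_sums B(1) sub Y by blast
  define F where "F x = max_over T (\<lambda>v. \<Sum>k\<in>J. ramp \<rho> (x k \<bullet> v))" for x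
  have F_meas: "F \<in> borel_measurable (PiM J (\<lambda>_. borel))"
    unfolding F_def by (intro borel_measurable_max_over T borel_measurable_sum) measurable
  have F_bound: "\<bar>F x\<bar> \<le> K" for x
  proof -
    obtain v where "F x = (\<Sum>k\<in>J. ramp \<rho> (x k \<bullet> v))"
      unfolding F_def using max_over_attained[OF T] by blast
    moreover have "\<dots> \<ge> 0" by (intro sum_nonneg ramp_bounds)
    moreover have "(\<Sum>k\<in>J. ramp \<rho> (x k \<bullet> v)) \<le> K"
      using sum_bounded_above[of J "\<lambda>k. ramp \<rho> (x k \<bullet> v)" 1] ramp_bounds by (simp add: K_def)
    ultimately show ?thesis by simp
  qed
  have F_le: "F x \<le> F x' + 1" if eq: "\<And>k. k \<noteq> j \<Longrightarrow> x k = x' k" and j: "j \<in> J" for x x' j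
    unfolding F_def
  proof (rule max_over_diff_le[OF T])
    fix v
    have "(\<Sum>k\<in>J. ramp \<rho> (x k \<bullet> v)) = ramp \<rho> (x j \<bullet> v) + (\<Sum>k\<in>J-{j}. ramp \<rho> (x' k \<bullet> v))"
      using fin j eq by (simp add: sum.remove)
    moreover have "(\<Sum>k\<in>J. ramp \<rho> (x' k \<bullet> v)) = ramp \<rho> (x' j \<bullet> v) + (\<Sum>k\<in>J-{j}. ramp \<rho> (x' k \<bullet> v))"
      using fin j by (simp add: sum.remove)
    ultimately show "(\<Sum>k\<in>J. ramp \<rho> (x k \<bullet> v)) \<le> (\<Sum>k\<in>J. ramp \<rho> (x' k \<bullet> v)) + 1"
      using ramp_bounds(2)[of \<rho> "x j \<bullet> v"] ramp_bounds(1)[of \<rho> "x' j \<bullet> v"] by linarith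
  qed
  have F_diff: "\<bar>F (x(j := y)) - F x\<bar> \<le> 1" if "j \<in> J" for x j y
    using F_le[of j "x(j := y)" x] F_le[of j x "x(j := y)"] that by (simp add: abs_le_iff)
  have F_restrict: "F (\<lambda>k\<in>J. W k \<omega>) = F (\<lambda>k. W k \<omega>)" for \<omega>
    unfolding F_def by (intro arg_cong[where f = "max_over T"] ext sum.cong) auto
  have F_W [measurable]: "(\<lambda>\<omega>. F (\<lambda>k. W k \<omega>)) \<in> borel_measurable M"
    unfolding F_def by (intro borel_measurable_max_over T borel_measurable_sum) measurable
  have int_F: "integrable M (\<lambda>\<omega>. F (\<lambda>k. W k \<omega>))"
    using F_bound by (intro integrable_const_bound[where B = K]) auto
  have int_r: "integrable M (\<lambda>\<omega>. ramp \<rho> (W k \<omega> \<bullet> v))" if "k \<in> J" for k v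
    using ramp_bounds that by (intro integrable_const_bound[where B = 1]) auto
  have mean_r: "expectation (\<lambda>\<omega>. ramp \<rho> (W k \<omega> \<bullet> v)) \<le> 1 / 64" if "k \<in> J" "v \<in> T" for k v
  proof -
    have "expectation (\<lambda>\<omega>. ramp \<rho> (W k \<omega> \<bullet> v)) \<le> expectation (\<lambda>\<omega>. (W k \<omega> \<bullet> v)\<^sup>2 / \<rho>\<^sup>2)"
      using int_r[OF that(1)] sq[OF that] ramp_le_square[of \<rho>]
      by (intro integral_mono) (auto simp: W_def power_divide)
    also have "\<dots> \<le> 1 / 64"
      using var[OF that] \<rho> by (simp add: W_def field_simps)
    finally show ?thesis .
  qed
  define D where "D \<omega> = max_over T (\<lambda>v. \<Sum>k\<in>J. ramp \<rho> (W k \<omega> \<bullet> v) - expectation (\<lambda>\<omega>. ramp \<rho> (W k \<omega> \<bullet> v)))" for \<omega>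
  have int_D: "integrable M D"
    unfolding D_def using int_r by (auto intro!: integrable_max_over T)
  have F_D: "F (\<lambda>k. W k \<omega>) \<le> D \<omega> + K / 64" for \<omega>
    unfolding F_def D_def
  proof (rule max_over_diff_le[OF T])
    fix v assume v: "v \<in> T"
    have "(\<Sum>k\<in>J. expectation (\<lambda>\<omega>. ramp \<rho> (W k \<omega> \<bullet> v))) \<le> K / 64"
      using sum_bounded_above[of J "\<lambda>k. expectation (\<lambda>\<omega>. ramp \<rho> (W k \<omega> \<bullet> v))" "1/64"] mean_r[OF _ v]
      by (simp add: K_def)
    then show "(\<Sum>k\<in>J. ramp \<rho> (W k \<omega> \<bullet> v))
      \<le> (\<Sum>k\<in>J. ramp \<rho> (W k \<omega> \<bullet> v) - expectation (\<lambda>\<omega>. ramp \<rho> (W k \<omega> \<bullet> v))) + K / 64"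
      by (simp add: sum_subtractf)
  qed
  have "expectation D \<le> 4 * (2 / \<rho>) * expectation (\<lambda>\<omega>. max_over T (\<lambda>v. (\<Sum>i\<in>I. Z i \<omega>) \<bullet> v))"
    unfolding D_def W_def using fin(1) B \<rho> ramp_lipschitz ramp_bounds
    by (intro expectation_max_blocks_le_symmetrized[where C = 1]) (auto simp del: times_divide_eq_left)
  also have "\<dots> \<le> K / 8"
    using rad \<rho> by (simp add: field_simps K_def)
  finally have ED: "expectation D \<le> K / 8" .
  have "expectation (\<lambda>\<omega>. F (\<lambda>k. W k \<omega>)) \<le> expectation (\<lambda>\<omega>. D \<omega> + K / 64)"
    using int_F int_D F_D by (intro integral_mono) auto
  also have "\<dots> \<le> 9 * K / 64" using int_D ED by (simp add: prob_space)
  finally have EF: "expectation (\<lambda>\<omega>. F (\<lambda>k. W k \<omega>)) \<le> 9 * K / 64" .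
  define bad where "bad = {\<omega>\<in>space M. expectation (\<lambda>\<omega>. F (\<lambda>k. W k \<omega>)) + K / 32 \<le> F (\<lambda>k. W k \<omega>)}"
  have bad: "bad \<in> events" unfolding bad_def by measurable
  have "prob bad \<le> exp (- 2 * (K / 32)\<^sup>2 / (\<Sum>k\<in>J. 1\<^sup>2))"
    using bounded_differences_ineq_indep_vars[OF fin W_ind F_meas F_bound F_diff, where t = "K / 32",
        unfolded F_restrict] K fin
    by (simp add: bad_def card_gt_0_iff)
  also have "- 2 * (K / 32)\<^sup>2 / (\<Sum>k\<in>J. 1\<^sup>2) = - K / 512"
    using K by (simp add: K_def[symmetric] power2_eq_square)
  finally have pbad: "prob bad \<le> exp (- K / 512)" .
  define good where "good = {\<omega>\<in>space M. \<forall>v\<in>T. (\<Sum>k\<in>J. ramp \<rho> (W k \<omega> \<bullet> v)) \<le> 3 * K / 16}"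
  have good_eq: "good = {\<omega>\<in>space M. F (\<lambda>k. W k \<omega>) \<le> 3 * K / 16}"
    unfolding good_def F_def max_over_le_iff[OF T] ..
  have good: "good \<in> events" unfolding good_eq by measurable
  have "space M - bad \<subseteq> good"
  proof
    fix \<omega> assume "\<omega> \<in> space M - bad"
    then have "\<omega> \<in> space M" "F (\<lambda>k. W k \<omega>) < expectation (\<lambda>\<omega>. F (\<lambda>k. W k \<omega>)) + K / 32"
      by (auto simp: bad_def)
    then show "\<omega> \<in> good" using EF K by (simp add: good_eq)
  qed
  then have "1 - prob bad \<le> prob good"
    using prob_compl[OF bad] finite_measure_mono[OF _ good] by metis
  then have "1 - exp (- K / 512) \<le> prob good" using pbad by linarith
  with good show "{\<omega>\<in>space M. \<forall>v\<in>T. (\<Sum>k\<in>J. ramp \<rho> ((\<Sum>i\<in>B k. Y i \<omega>) \<bullet> v)) \<le> 3 * card J / 16} \<in> events"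
    "1 - exp (- real (card J) / 512)
      \<le> prob {\<omega>\<in>space M. \<forall>v\<in>T. (\<Sum>k\<in>J. ramp \<rho> ((\<Sum>i\<in>B k. Y i \<omega>) \<bullet> v)) \<le> 3 * card J / 16}"
    by (simp_all add: good_def W_def K_def)
qed

end
end

section \<open>Rademacher signs independent of the sample\<close>

text \<open>
  The independence of the families \<open>U\<close> and \<open>V\<close>, in the form of the definition
  \<open>indep_families\<close>, is passed on to real functions of them. These have a common value type, so
  the product rule for expectations of independent variables applies to them.
\<close>

lemma (in prob_space) indep_families_indep_var:
  fixes U :: "'i \<Rightarrow> 'a \<Rightarrow> 'b::topological_space" and V :: "'i \<Rightarrow> 'a \<Rightarrow> 'c::topological_space"
    and p :: "('i \<Rightarrow> 'b) \<Rightarrow> real" and q :: "('i \<Rightarrow> 'c) \<Rightarrow> real"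
  assumes ind: "indep_set (sets (vimage_algebra (space M) (\<lambda>\<omega>. \<lambda>i\<in>I. U i \<omega>) (PiM I (\<lambda>_. borel))))
     (sets (vimage_algebra (space M) (\<lambda>\<omega>. \<lambda>i\<in>I. V i \<omega>) (PiM I (\<lambda>_. borel))))"
    and U: "\<And>i. i \<in> I \<Longrightarrow> U i \<in> borel_measurable M" and V: "\<And>i. i \<in> I \<Longrightarrow> V i \<in> borel_measurable M"
    and p: "p \<in> borel_measurable (PiM I (\<lambda>_. borel))" and q: "q \<in> borel_measurable (PiM I (\<lambda>_. borel))"
  shows "indep_var borel (\<lambda>\<omega>. p (\<lambda>i\<in>I. U i \<omega>)) borel (\<lambda>\<omega>. q (\<lambda>i\<in>I. V i \<omega>))"
proof -
  have gen: "sigma_sets (space M) {(\<lambda>\<omega>. r (\<lambda>i\<in>I. W i \<omega>)) -` A \<inter> space M |A. A \<in> sets (borel :: real measure)}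
      \<subseteq> sets (vimage_algebra (space M) (\<lambda>\<omega>. \<lambda>i\<in>I. W i \<omega>) (PiM I (\<lambda>_. borel)))"
    if r: "r \<in> borel_measurable (PiM I (\<lambda>_. borel))"
    for W :: "'i \<Rightarrow> 'a \<Rightarrow> 'e::topological_space" and r :: "('i \<Rightarrow> 'e) \<Rightarrow> real"
  proof -
    let ?N = "vimage_algebra (space M) (\<lambda>\<omega>. \<lambda>i\<in>I. W i \<omega>) (PiM I (\<lambda>_. borel))"
    have "(\<lambda>\<omega>. r (\<lambda>i\<in>I. W i \<omega>)) \<in> borel_measurable ?N"
      by (rule measurable_compose[OF measurable_vimage_algebra1 r]) (auto simp: space_PiM)
    then have "{(\<lambda>\<omega>. r (\<lambda>i\<in>I. W i \<omega>)) -` A \<inter> space M |A. A \<in> sets (borel :: real measure)} \<subseteq> sets ?N"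
      by (auto dest: measurable_sets)
    then show ?thesis
      using sets.sigma_sets_subset[of _ ?N] by simp
  qed
  show ?thesis unfolding indep_var_eq
  proof (intro conjI)
    show "(\<lambda>\<omega>. p (\<lambda>i\<in>I. U i \<omega>)) \<in> borel_measurable M"
      by (rule measurable_compose[OF measurable_restrict[OF U] p])
    show "(\<lambda>\<omega>. q (\<lambda>i\<in>I. V i \<omega>)) \<in> borel_measurable M"
      by (rule measurable_compose[OF measurable_restrict[OF V] q])
    show "indep_set
      (sigma_sets (space M) {(\<lambda>\<omega>. p (\<lambda>i\<in>I. U i \<omega>)) -` A \<inter> space M |A. A \<in> sets borel})
      (sigma_sets (space M) {(\<lambda>\<omega>. q (\<lambda>i\<in>I. V i \<omega>)) -` A \<inter> space M |A. A \<in> sets borel})"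
      using ind unfolding indep_set_def
      by (rule indep_sets_mono_sets) (use gen[OF p] gen[OF q] in \<open>auto split: bool.split\<close>)
  qed
qed

text \<open>
  Rectangles generate the product \<open>\<sigma>\<close>-algebra, and on rectangles the probability of an
  intersection factors first between the two families and then within each of them.
\<close>

lemma (in prob_space) indep_vars_pairs:
  fixes U :: "'i \<Rightarrow> 'a \<Rightarrow> 'b::second_countable_topology" and V :: "'i \<Rightarrow> 'a \<Rightarrow> 'c::second_countable_topology"
  assumes I: "finite I" "I \<noteq> {}" and U: "indep_vars (\<lambda>_. borel) U I" and V: "indep_vars (\<lambda>_. borel) V I"
    and UV: "indep_families M I U V"
  shows "indep_vars (\<lambda>_. borel \<Otimes>\<^sub>M borel) (\<lambda>i \<omega>. (U i \<omega>, V i \<omega>)) I"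
proof -
  have rvU: "U i \<in> borel_measurable M" if "i \<in> I" for i using U that by (auto simp: indep_vars_def2)
  have rvV: "V i \<in> borel_measurable M" if "i \<in> I" for i using V that by (auto simp: indep_vars_def2)
  have joint: "prob ((\<Inter>j\<in>I. U j -` a j \<inter> space M) \<inter> (\<Inter>j\<in>I. V j -` b j \<inter> space M))
      = prob (\<Inter>j\<in>I. U j -` a j \<inter> space M) * prob (\<Inter>j\<in>I. V j -` b j \<inter> space M)"
    if ab: "\<And>j. j \<in> I \<Longrightarrow> a j \<in> sets borel" "\<And>j. j \<in> I \<Longrightarrow> b j \<in> sets borel" for a b
  proof (rule indep_setD[OF UV[unfolded indep_families_def]])
    have eq: "(\<lambda>\<omega>. \<lambda>i\<in>I. U i \<omega>) -` Pi\<^sub>E I a \<inter> space M = (\<Inter>j\<in>I. U j -` a j \<inter> space M)"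
      using I(2) by (auto simp: PiE_iff)
    show "(\<Inter>j\<in>I. U j -` a j \<inter> space M)
        \<in> sets (vimage_algebra (space M) (\<lambda>\<omega>. \<lambda>i\<in>I. U i \<omega>) (PiM I (\<lambda>_. borel)))"
      unfolding eq[symmetric] using ab I by (intro in_vimage_algebra sets_PiM_I_finite) auto
    have eq: "(\<lambda>\<omega>. \<lambda>i\<in>I. V i \<omega>) -` Pi\<^sub>E I b \<inter> space M = (\<Inter>j\<in>I. V j -` b j \<inter> space M)"
      using I(2) by (auto simp: PiE_iff)
    show "(\<Inter>j\<in>I. V j -` b j \<inter> space M)
        \<in> sets (vimage_algebra (space M) (\<lambda>\<omega>. \<lambda>i\<in>I. V i \<omega>) (PiM I (\<lambda>_. borel)))"
      unfolding eq[symmetric] using ab I by (intro in_vimage_algebra sets_PiM_I_finite) auto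
  qed
  have single: "prob (U j -` a \<inter> space M \<inter> (V j -` b \<inter> space M)) = prob (U j -` a \<inter> space M) * prob (V j -` b \<inter> space M)"
    if "j \<in> I" "a \<in> sets borel" "b \<in> sets borel" for j a b
  proof -
    have "(\<Inter>i\<in>I. U i -` (if i = j then a else UNIV) \<inter> space M) = U j -` a \<inter> space M"
      "(\<Inter>i\<in>I. V i -` (if i = j then b else UNIV) \<inter> space M) = V j -` b \<inter> space M"
      using that(1) by (auto split: if_splits)
    then show ?thesis
      using joint[of "\<lambda>i. if i = j then a else UNIV" "\<lambda>i. if i = j then b else UNIV"] that by simp
  qed
  have gen: "sets (borel \<Otimes>\<^sub>M borel :: ('b \<times> 'c) measure)
    = sigma_sets (space (borel \<Otimes>\<^sub>M borel)) {a \<times> b |a b. a \<in> sets borel \<and> b \<in> sets borel}"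
    by (simp add: sets_pair_measure space_pair_measure)
  let ?E = "\<lambda>_ :: 'i. {a \<times> b |a b. a \<in> sets (borel :: 'b measure) \<and> b \<in> sets (borel :: 'c measure)}"
  have "indep_vars (\<lambda>_. borel \<Otimes>\<^sub>M borel) (\<lambda>i \<omega>. (U i \<omega>, V i \<omega>)) I \<longleftrightarrow>
    (\<forall>A\<in>Pi I ?E. prob (\<Inter>j\<in>I. (\<lambda>\<omega>. (U j \<omega>, V j \<omega>)) -` A j \<inter> space M)
       = (\<Prod>j\<in>I. prob ((\<lambda>\<omega>. (U j \<omega>, V j \<omega>)) -` A j \<inter> space M)))"
  proof (rule indep_vars_finite)
    show "I \<noteq> {}" "finite I" by fact+
    fix i assume i: "i \<in> I"
    show "sets (borel \<Otimes>\<^sub>M borel :: ('b \<times> 'c) measure) = sigma_sets (space (borel \<Otimes>\<^sub>M borel)) (?E i)"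
      by (rule gen)
    show "(\<lambda>\<omega>. (U i \<omega>, V i \<omega>)) \<in> measurable M (borel \<Otimes>\<^sub>M borel)"
      using rvU[OF i] rvV[OF i] by measurable
    show "Int_stable (?E i)" by (rule Int_stable_pair_measure_generator)
    show "space (borel \<Otimes>\<^sub>M borel) \<in> ?E i"
      unfolding space_pair_measure by blast
    show "?E i \<subseteq> Pow (space (borel \<Otimes>\<^sub>M borel))" by (auto simp: space_pair_measure)
  qed
  also have "\<dots>"
    proof
      fix A :: "'i \<Rightarrow> ('b \<times> 'c) set"
      assume "A \<in> Pi I ?E"
      then have "\<forall>j\<in>I. \<exists>a b. A j = a \<times> b \<and> a \<in> sets borel \<and> b \<in> sets borel" by auto
      then obtain a b where ab: "\<And>j. j \<in> I \<Longrightarrow> A j = a j \<times> b j"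
        "\<And>j. j \<in> I \<Longrightarrow> a j \<in> sets borel" "\<And>j. j \<in> I \<Longrightarrow> b j \<in> sets borel"
        by metis
      have split: "(\<lambda>\<omega>. (U j \<omega>, V j \<omega>)) -` A j \<inter> space M = U j -` a j \<inter> space M \<inter> (V j -` b j \<inter> space M)"
        if "j \<in> I" for j using ab(1)[OF that] by auto
      have "(\<Inter>j\<in>I. (\<lambda>\<omega>. (U j \<omega>, V j \<omega>)) -` A j \<inter> space M)
          = (\<Inter>j\<in>I. U j -` a j \<inter> space M) \<inter> (\<Inter>j\<in>I. V j -` b j \<inter> space M)"
        using split I(2) by auto
      then have "prob (\<Inter>j\<in>I. (\<lambda>\<omega>. (U j \<omega>, V j \<omega>)) -` A j \<inter> space M)
          = (\<Prod>j\<in>I. prob (U j -` a j \<inter> space M)) * (\<Prod>j\<in>I. prob (V j -` b j \<inter> space M))"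
        using joint[of a b] ab indep_varsD_finite[OF U I(2,1), of a] indep_varsD_finite[OF V I(2,1), of b] by simp
      also have "\<dots> = (\<Prod>j\<in>I. prob ((\<lambda>\<omega>. (U j \<omega>, V j \<omega>)) -` A j \<inter> space M))"
        unfolding prod.distrib[symmetric] using split single ab by (intro prod.cong) auto
      finally show "prob (\<Inter>j\<in>I. (\<lambda>\<omega>. (U j \<omega>, V j \<omega>)) -` A j \<inter> space M)
       = (\<Prod>j\<in>I. prob ((\<lambda>\<omega>. (U j \<omega>, V j \<omega>)) -` A j \<inter> space M))" .
    qed
  finally show ?thesis .
qed

text \<open>
  Almost surely \<open>h (\<epsilon> i *\<^sub>R y)\<close> is \<open>h y\<close> on the event \<open>\<epsilon> i = 1\<close> and \<open>h (- y)\<close> on the event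
  \<open>\<epsilon> i = - 1\<close>. Both events have probability one half and are independent of the sample, which
  gives the mixture of laws.
\<close>

lemma (in prob_space) symmetrized_sample_rademacher:
  fixes V :: "'i \<Rightarrow> 'a \<Rightarrow> real ^ 'd"
  assumes I: "finite I" "I \<noteq> {}" and \<epsilon>: "indep_vars (\<lambda>_. borel) \<epsilon> I" and V: "indep_vars (\<lambda>_. borel) V I"
    and \<epsilon>V: "indep_families M I \<epsilon> V"
    and rad: "\<And>i. i \<in> I \<Longrightarrow> rademacher M (\<epsilon> i)"
    and mean: "\<And>i. i \<in> I \<Longrightarrow> integrable M (V i) \<and> expectation (V i) = \<mu>"
  shows "symmetrized_sample M I (\<lambda>i \<omega>. V i \<omega> - \<mu>) (\<lambda>i \<omega>. \<epsilon> i \<omega> *\<^sub>R (V i \<omega> - \<mu>))"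
proof (unfold_locales, rule I(1))
  have rv\<epsilon>: "\<epsilon> i \<in> borel_measurable M" if "i \<in> I" for i using \<epsilon> that by (auto simp: indep_vars_def2)
  have rvV: "V i \<in> borel_measurable M" if "i \<in> I" for i using V that by (auto simp: indep_vars_def2)
  have AE_sign: "AE \<omega> in M. \<epsilon> i \<omega> = 1 \<or> \<epsilon> i \<omega> = - 1" if i: "i \<in> I" for i
  proof -
    note [measurable] = rv\<epsilon>[OF i]
    have "prob ({\<omega>\<in>space M. \<epsilon> i \<omega> = 1} \<union> {\<omega>\<in>space M. \<epsilon> i \<omega> = - 1})
        = prob {\<omega>\<in>space M. \<epsilon> i \<omega> = 1} + prob {\<omega>\<in>space M. \<epsilon> i \<omega> = - 1}"
      by (rule finite_measure_Union) auto
    then have "prob ({\<omega>\<in>space M. \<epsilon> i \<omega> = 1} \<union> {\<omega>\<in>space M. \<epsilon> i \<omega> = - 1}) = 1"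
      using rad[OF i] by (simp add: rademacher_def)
    then have "AE \<omega> in M. \<omega> \<in> {\<omega>\<in>space M. \<epsilon> i \<omega> = 1} \<union> {\<omega>\<in>space M. \<epsilon> i \<omega> = - 1}"
      by (rule AE_prob_1)
    then show ?thesis by (rule AE_mp) auto
  qed
  show "indep_vars (\<lambda>_. borel) (\<lambda>i \<omega>. V i \<omega> - \<mu>) I"
    using indep_vars_compose2[OF V, of "\<lambda>_ x. x - \<mu>" "\<lambda>_. borel"] by simp
  show "indep_vars (\<lambda>_. borel) (\<lambda>i \<omega>. \<epsilon> i \<omega> *\<^sub>R (V i \<omega> - \<mu>)) I"
    using indep_vars_compose2[OF indep_vars_pairs[OF I \<epsilon> V \<epsilon>V], of "\<lambda>_ (e, x). e *\<^sub>R (x - \<mu>)" "\<lambda>_. borel"]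
    by simp
  fix i assume i: "i \<in> I"
  note [measurable] = rv\<epsilon>[OF i] rvV[OF i]
  show int: "integrable M (\<lambda>\<omega>. V i \<omega> - \<mu>)" and "expectation (\<lambda>\<omega>. V i \<omega> - \<mu>) = 0"
    using mean[OF i] by (auto simp: prob_space)
  show "integrable M (\<lambda>\<omega>. \<epsilon> i \<omega> *\<^sub>R (V i \<omega> - \<mu>))"
    by (rule Bochner_Integration.integrable_bound[OF int]) (use AE_sign[OF i] in \<open>auto elim!: eventually_mono\<close>)
  fix h :: "real ^ 'd \<Rightarrow> real"
  assume h [measurable]: "h \<in> borel_measurable borel"
    and int_h: "integrable M (\<lambda>\<omega>. h (V i \<omega> - \<mu>))" "integrable M (\<lambda>\<omega>. h (- (V i \<omega> - \<mu>)))"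
  have half: "integrable M (\<lambda>\<omega>. indicator {s} (\<epsilon> i \<omega>) * q (V i \<omega>)) \<and>
      expectation (\<lambda>\<omega>. indicator {s} (\<epsilon> i \<omega>) * q (V i \<omega>)) = expectation (\<lambda>\<omega>. q (V i \<omega>)) / 2"
    if s: "s = 1 \<or> s = - 1" and q [measurable]: "q \<in> borel_measurable borel" and int_q: "integrable M (\<lambda>\<omega>. q (V i \<omega>))"
    for s :: real and q :: "real ^ 'd \<Rightarrow> real"
  proof -
    have "indep_var borel (\<lambda>\<omega>. indicator {s} ((\<lambda>i\<in>I. \<epsilon> i \<omega>) i) :: real) borel (\<lambda>\<omega>. q ((\<lambda>i\<in>I. V i \<omega>) i))"
      using i by (intro indep_families_indep_var[OF \<epsilon>V[unfolded indep_families_def] rv\<epsilon> rvV]) measurable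
    then have iv: "indep_var borel (\<lambda>\<omega>. indicator {s} (\<epsilon> i \<omega>) :: real) borel (\<lambda>\<omega>. q (V i \<omega>))"
      using i by simp
    have int_s: "integrable M (\<lambda>\<omega>. indicator {s} (\<epsilon> i \<omega>) :: real)"
      by (intro integrable_const_bound[where B = 1]) (auto simp: indicator_def)
    have "expectation (\<lambda>\<omega>. indicator {s} (\<epsilon> i \<omega>) :: real) = expectation (indicator {\<omega>\<in>space M. \<epsilon> i \<omega> = s})"
      by (intro Bochner_Integration.integral_cong) (auto simp: indicator_def)
    also have "\<dots> = 1 / 2"
      using s rad[OF i] by (auto simp: rademacher_def)
    finally show ?thesis
      using indep_var_integrable[OF iv int_s int_q] indep_var_lebesgue_integral[OF iv int_s int_q] by simp
  qed
  have "expectation (\<lambda>\<omega>. h (\<epsilon> i \<omega> *\<^sub>R (V i \<omega> - \<mu>)))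
      = expectation (\<lambda>\<omega>. indicator {1} (\<epsilon> i \<omega>) * h (V i \<omega> - \<mu>) + indicator {- 1} (\<epsilon> i \<omega>) * h (- (V i \<omega> - \<mu>)))"
    by (rule integral_cong_AE) (use AE_sign[OF i] in \<open>auto elim!: eventually_mono\<close>)
  also have "\<dots> = (expectation (\<lambda>\<omega>. h (V i \<omega> - \<mu>)) + expectation (\<lambda>\<omega>. h (- (V i \<omega> - \<mu>)))) / 2"
    using half[of 1 "\<lambda>x. h (x - \<mu>)"] half[of "- 1" "\<lambda>x. h (- (x - \<mu>))"] int_h
    by (subst Bochner_Integration.integral_add) auto
  finally show "expectation (\<lambda>\<omega>. h (\<epsilon> i \<omega> *\<^sub>R (V i \<omega> - \<mu>)))
      = (expectation (\<lambda>\<omega>. h (V i \<omega> - \<mu>)) + expectation (\<lambda>\<omega>. h (- (V i \<omega> - \<mu>)))) / 2" .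
qed

section \<open>Square roots of positive semi-definite matrices and second moments\<close>

text \<open>
  A maximizer \<open>b\<close> of the Rayleigh quotient on the unit sphere of \<open>V\<close> is an eigenvector: otherwise
  the component \<open>w\<close> of \<open>f b\<close> orthogonal to \<open>b\<close> is nonzero, and moving from \<open>b\<close> slightly towards \<open>w\<close>
  increases the quotient to first order.
\<close>

lemma self_adjoint_eigenvector:
  fixes f :: "'a::euclidean_space \<Rightarrow> 'a"
  assumes f: "linear f" and sa: "\<And>x y. f x \<bullet> y = x \<bullet> f y"
    and V: "subspace V" "\<And>x. x \<in> V \<Longrightarrow> f x \<in> V" "V \<noteq> {0}"
  shows "\<exists>b\<in>V. norm b = 1 \<and> f b = (b \<bullet> f b) *\<^sub>R b"
proof -
  have "compact (V \<inter> sphere 0 1)"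
    using closed_subspace[OF V(1)] by (simp add: closed_Int_compact)
  moreover have "V \<inter> sphere 0 1 \<noteq> {}"
  proof -
    obtain x where x: "x \<in> V" "x \<noteq> 0" using V(1,3) subspace_0 by blast
    then have "x /\<^sub>R norm x \<in> V \<inter> sphere 0 1" using V(1) by (simp add: subspace_scale)
    then show ?thesis by blast
  qed
  moreover have "continuous_on (V \<inter> sphere 0 1) (\<lambda>x. x \<bullet> f x)"
    using f by (intro continuous_intros linear_continuous_on) (simp add: linear_conv_bounded_linear)
  ultimately obtain b where b: "b \<in> V \<inter> sphere 0 1"
    and max: "\<And>x. x \<in> V \<inter> sphere 0 1 \<Longrightarrow> x \<bullet> f x \<le> b \<bullet> f b"
    using continuous_attains_sup by metis
  define m where "m = b \<bullet> f b"
  have nb: "b \<bullet> b = 1" using b by (simp add: dot_square_norm)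
  have quad: "x \<bullet> f x \<le> m * (x \<bullet> x)" if x: "x \<in> V" for x
  proof (cases "x = 0")
    case True then show ?thesis using f by (simp add: linear_0)
  next
    case False
    define y where "y = x /\<^sub>R norm x"
    have "y \<bullet> f y \<le> m" unfolding m_def using False x V(1) by (intro max) (simp add: y_def subspace_scale)
    moreover have "y \<bullet> f y = (x \<bullet> f x) / (norm x)\<^sup>2"
      using f by (simp add: y_def linear_scale power2_eq_square divide_inverse)
    ultimately show ?thesis using False by (simp add: field_simps dot_square_norm)
  qed
  define w where "w = f b - m *\<^sub>R b"
  have wV: "w \<in> V" using b V by (auto simp: w_def subspace_diff subspace_scale)
  have bw: "b \<bullet> w = 0" using nb by (simp add: w_def inner_diff_right m_def)
  have fbw: "w \<bullet> f b = w \<bullet> w" using bw by (simp add: w_def inner_diff_right inner_commute)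
  have "w = 0"
  proof (rule ccontr)
    assume "w \<noteq> 0"
    then have pos: "w \<bullet> w > 0" by simp
    \<comment> \<open>The step \<open>t\<close> is chosen so that the gain \<open>2 * t * (w \<bullet> w)\<close> exceeds the second-order loss,
      which is at most \<open>t\<^sup>2 * c = t * (w \<bullet> w)\<close>.\<close>
    define c where "c = \<bar>m * (w \<bullet> w) - w \<bullet> f w\<bar> + 1"
    define t where "t = (w \<bullet> w) / c"
    have c: "c > 0" by (simp add: c_def)
    have t: "t > 0" using pos c by (simp add: t_def)
    have "(b + t *\<^sub>R w) \<bullet> f (b + t *\<^sub>R w) \<le> m * ((b + t *\<^sub>R w) \<bullet> (b + t *\<^sub>R w))"
      using b wV V(1) by (intro quad) (auto simp: subspace_add subspace_scale)
    moreover have "(b + t *\<^sub>R w) \<bullet> f (b + t *\<^sub>R w) = m + 2 * t * (w \<bullet> w) + t\<^sup>2 * (w \<bullet> f w)"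
    proof -
      have "b \<bullet> f w = w \<bullet> w" using sa[of b w] fbw by (simp add: inner_commute)
      then show ?thesis
        using f fbw by (simp add: linear_add linear_scale inner_add_left inner_add_right m_def
          power2_eq_square algebra_simps)
    qed
    moreover have "(b + t *\<^sub>R w) \<bullet> (b + t *\<^sub>R w) = 1 + t\<^sup>2 * (w \<bullet> w)"
      using nb bw inner_commute[of w b] by (simp add: inner_add_left inner_add_right power2_eq_square)
    ultimately have "m + 2 * t * (w \<bullet> w) + t\<^sup>2 * (w \<bullet> f w) \<le> m * (1 + t\<^sup>2 * (w \<bullet> w))"
      by (simp only:)
    then have "2 * t * (w \<bullet> w) \<le> t\<^sup>2 * (m * (w \<bullet> w) - w \<bullet> f w)"
      by (simp add: algebra_simps)
    also have "\<dots> \<le> t\<^sup>2 * c" by (intro mult_left_mono) (auto simp: c_def)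
    also have "\<dots> = t * (w \<bullet> w)" using c by (simp add: t_def power2_eq_square)
    finally show False using t pos by simp
  qed
  then show ?thesis using b by (auto simp: w_def m_def)
qed

text \<open>
  Split off an eigenvector \<open>b\<close>. Its orthogonal complement in \<open>V\<close> is invariant and has a square
  root \<open>g\<close> by induction on the dimension. Requiring the values of \<open>g\<close> to lie in the subspace on
  which it is a square root forces \<open>g b = 0\<close>, so the rank-one term for \<open>b\<close> can simply be added.
\<close>

lemma self_adjoint_sqrt_on:
  fixes f :: "'a::euclidean_space \<Rightarrow> 'a"
  assumes f: "linear f" and sa: "\<And>x y. f x \<bullet> y = x \<bullet> f y" and pos: "\<And>x. 0 \<le> x \<bullet> f x"
    and V: "subspace V" "\<And>x. x \<in> V \<Longrightarrow> f x \<in> V"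
  shows "\<exists>g. linear g \<and> (\<forall>x. g x \<in> V) \<and> (\<forall>x y. g x \<bullet> y = x \<bullet> g y) \<and> (\<forall>x. 0 \<le> x \<bullet> g x) \<and>
    (\<forall>x\<in>V. g (g x) = f x)"
  using V
proof (induction "dim V" arbitrary: V rule: less_induct)
  case less
  show ?case
  proof (cases "V = {0}")
    case True
    then show ?thesis using f by (intro exI[of _ "\<lambda>_. 0"]) (auto simp: linear_0 module_hom_zero)
  next
    case False
    obtain b where b: "b \<in> V" "norm b = 1" and fb: "f b = (b \<bullet> f b) *\<^sub>R b"
      using self_adjoint_eigenvector[OF f sa less.prems False] by blast
    have nb: "b \<bullet> b = 1" using b by (simp add: dot_square_norm)
    define m where "m = b \<bullet> f b"
    define U where "U = V \<inter> {x. b \<bullet> x = 0}"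
    have subU: "subspace U" unfolding U_def by (intro subspace_inter less.prems subspace_hyperplane)
    have fU: "f x \<in> U" if "x \<in> U" for x
      using that less.prems(2) sa[of b x] fb by (auto simp: U_def) (metis inner_scaleR_left mult_zero_right)
    have "b \<notin> U" using nb by (simp add: U_def)
    then have "U \<subset> V" using b(1) unfolding U_def by blast
    then have "dim U < dim V"
      by (metis dim_psubset subU less.prems(1) span_eq_iff)
    then obtain g where g: "linear g" "\<And>x. g x \<in> U" "\<And>x y. g x \<bullet> y = x \<bullet> g y" "\<And>x. 0 \<le> x \<bullet> g x"
      "\<And>x. x \<in> U \<Longrightarrow> g (g x) = f x"
      using less.hyps[OF _ subU fU] by blast
    \<comment> \<open>By self-adjointness \<open>g b \<bullet> g b = b \<bullet> g (g b)\<close>, and \<open>g (g b)\<close> lies in \<open>U\<close>.\<close>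
    have gb: "g b = 0"
      using g(2)[of "g b"] g(3)[of b "g b"] by (simp add: U_def inner_eq_zero_iff)
    have bg: "b \<bullet> g x = 0" for x using g(2)[of x] by (simp add: U_def)
    define h where "h x = g x + (sqrt m * (b \<bullet> x)) *\<^sub>R b" for x
    have m: "0 \<le> m" by (simp add: m_def pos)
    have "linear h"
      unfolding h_def using g(1)
      by (intro linearI) (auto simp: linear_add linear_scale inner_add_right algebra_simps)
    moreover have "h x \<in> V" for x
      using g(2)[of x] b less.prems(1) by (auto simp: h_def U_def subspace_add subspace_scale)
    moreover have "h x \<bullet> y = x \<bullet> h y" for x y
      using g(3)[of x y] by (simp add: h_def inner_add_left inner_add_right inner_commute)
    moreover have "0 \<le> x \<bullet> h x" for x
    proof -
      have "x \<bullet> h x = x \<bullet> g x + sqrt m * (b \<bullet> x)\<^sup>2"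
        by (simp add: h_def inner_add_right inner_commute power2_eq_square)
      then show ?thesis using g(4)[of x] m by simp
    qed
    moreover have "h (h x) = f x" if x: "x \<in> V" for x
    proof -
      define u where "u = x - (b \<bullet> x) *\<^sub>R b"
      have "u \<in> U" using x b nb less.prems(1)
        by (auto simp: U_def u_def subspace_diff subspace_scale inner_diff_right)
      have xu: "x = u + (b \<bullet> x) *\<^sub>R b" by (simp add: u_def)
      have gx: "g x = g u" using g(1) gb by (simp add: u_def linear_diff linear_scale)
      have "h (h x) = g (g u) + (m * (b \<bullet> x)) *\<^sub>R b"
        using m nb bg g(1) gb by (simp add: h_def gx linear_add linear_scale inner_add_right)
      also have "\<dots> = f u + (b \<bullet> x) *\<^sub>R f b"
        using g(5)[OF \<open>u \<in> U\<close>] by (subst fb) (simp add: m_def mult.commute)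
      also have "\<dots> = f x" using linear_add[OF f, of u "(b \<bullet> x) *\<^sub>R b"] linear_scale[OF f, of "b \<bullet> x" b] xu by simp
      finally show ?thesis .
    qed
    ultimately show ?thesis by blast
  qed
qed

lemma symmetric_matrix_inner:
  fixes A :: "real ^ 'd ^ 'd"
  assumes "transpose A = A"
  shows "(A *v x) \<bullet> y = x \<bullet> (A *v y)"
proof -
  have "A *v x = x v* A" using transpose_matrix_vector[of A x] unfolding assms .
  then show ?thesis by (simp only: dot_lmul_matrix)
qed

lemma transpose_eq_self_if_self_adjoint:
  fixes A :: "real ^ 'd ^ 'd"
  assumes "\<And>x y. (A *v x) \<bullet> y = x \<bullet> (A *v y)"
  shows "transpose A = A"
proof -
  have "transpose A *v x = A *v x" for x
  proof (rule vector_eq_rdot[THEN iffD1], rule allI)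
    fix y show "(transpose A *v x) \<bullet> y = (A *v x) \<bullet> y"
      unfolding transpose_matrix_vector dot_lmul_matrix assms ..
  qed
  then show ?thesis by (simp add: matrix_eq)
qed

text \<open>
  The existence of a square root turns the choice in the definition of \<open>matrix_sqrt\<close> into a
  specification.
\<close>

lemma matrix_sqrt_correct:
  fixes C :: "real ^ 'd ^ 'd"
  assumes C: "pos_semidef C"
  shows "pos_semidef (matrix_sqrt C) \<and> matrix_sqrt C ** matrix_sqrt C = C"
proof -
  obtain g where g: "linear g" "\<And>x y. g x \<bullet> y = x \<bullet> g y" "\<And>x. 0 \<le> x \<bullet> g x" "\<And>x. g (g x) = C *v x"
  proof -
    have "(C *v x) \<bullet> y = x \<bullet> (C *v y)" "0 \<le> x \<bullet> (C *v x)" for x y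
      using C symmetric_matrix_inner[of C] by (auto simp: pos_semidef_def)
    then show ?thesis
      using self_adjoint_sqrt_on[of "(*v) C" UNIV] that by (metis UNIV_I matrix_vector_mul_linear subspace_UNIV)
  qed
  have mg: "matrix g *v x = g x" for x using g(1) by (simp add: matrix_works)
  have "pos_semidef (matrix g) \<and> matrix g ** matrix g = C"
    using transpose_eq_self_if_self_adjoint[of "matrix g"] g
    by (simp add: pos_semidef_def mg matrix_eq matrix_vector_mul_assoc[symmetric])
  then show ?thesis
    unfolding matrix_sqrt_def by (rule someI[where P = "\<lambda>R. pos_semidef R \<and> R ** R = C" and x = "matrix g"])
qed

lemma norm_matrix_sqrt_square:
  fixes C :: "real ^ 'd ^ 'd"
  assumes "pos_semidef C"
  shows "(norm (matrix_sqrt C *v v))\<^sup>2 = v \<bullet> (C *v v)"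
proof -
  define R where "R = matrix_sqrt C"
  have R: "transpose R = R" "R ** R = C"
    using matrix_sqrt_correct[OF assms] by (simp_all add: R_def pos_semidef_def)
  have "(norm (R *v v))\<^sup>2 = (R *v v) \<bullet> (R *v v)" by (rule power2_norm_eq_inner)
  also have "\<dots> = v \<bullet> (R *v (R *v v))" using R(1) by (rule symmetric_matrix_inner)
  also have "\<dots> = v \<bullet> (C *v v)" unfolding matrix_vector_mul_assoc R(2) ..
  finally show ?thesis by (simp add: R_def)
qed

lemma inner_outer_square: "v \<bullet> (outer_square y *v v) = (y \<bullet> v)\<^sup>2"
proof -
  have "v \<bullet> (outer_square y *v v) = (\<Sum>i\<in>UNIV. \<Sum>j\<in>UNIV. (y $ i * v $ i) * (y $ j * v $ j))"
    by (simp add: outer_square_def inner_vec_def matrix_vector_mult_def sum_distrib_left mult_ac)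
  also have "\<dots> = (y \<bullet> v)\<^sup>2"
    unfolding sum_product[symmetric] by (simp add: inner_vec_def power2_eq_square)
  finally show ?thesis .
qed

lemma bounded_linear_quadratic_form: "bounded_linear (\<lambda>A :: real ^ 'd ^ 'd. v \<bullet> (A *v v))"
  unfolding linear_conv_bounded_linear[symmetric]
  by (rule linearI)
    (simp_all add: matrix_vector_mult_add_rdistrib inner_add_right scaleR_matrix_vector_assoc[symmetric])

lemma directional_second_moment_le:
  fixes y :: "'a \<Rightarrow> real ^ 'd"
  assumes C: "pos_semidef C" and int: "integrable M (\<lambda>\<omega>. outer_square (y \<omega>))"
    and le: "loewner_le (\<integral>\<omega>. outer_square (y \<omega>) \<partial>M) C"
  shows "integrable M (\<lambda>\<omega>. (y \<omega> \<bullet> v)\<^sup>2)"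
    and "(\<integral>\<omega>. (y \<omega> \<bullet> v)\<^sup>2 \<partial>M) \<le> (norm (matrix_sqrt C *v v))\<^sup>2"
proof -
  show "integrable M (\<lambda>\<omega>. (y \<omega> \<bullet> v)\<^sup>2)"
    using integrable_bounded_linear[OF bounded_linear_quadratic_form int, of v] by (simp add: inner_outer_square)
  have "(\<integral>\<omega>. (y \<omega> \<bullet> v)\<^sup>2 \<partial>M) = v \<bullet> ((\<integral>\<omega>. outer_square (y \<omega>) \<partial>M) *v v)"
    using integral_bounded_linear[OF bounded_linear_quadratic_form int, of v] by (simp add: inner_outer_square)
  also have "\<dots> \<le> v \<bullet> (C *v v)"
    using le by (simp add: loewner_le_def pos_semidef_def matrix_vector_mult_diff_rdistrib inner_diff_right)
  finally show "(\<integral>\<omega>. (y \<omega> \<bullet> v)\<^sup>2 \<partial>M) \<le> (norm (matrix_sqrt C *v v))\<^sup>2"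
    by (simp add: norm_matrix_sqrt_square[OF C])
qed

text \<open>
  Independent centred variables are uncorrelated, so the cross terms in the square of the sum
  have mean zero.
\<close>

lemma (in prob_space) expectation_square_sum_centered:
  fixes X :: "'i \<Rightarrow> 'a \<Rightarrow> real"
  assumes I: "finite I" and ind: "indep_vars (\<lambda>_. borel) X I"
    and int: "\<And>i. i \<in> I \<Longrightarrow> integrable M (X i)" and mean: "\<And>i. i \<in> I \<Longrightarrow> expectation (X i) = 0"
    and sq: "\<And>i. i \<in> I \<Longrightarrow> integrable M (\<lambda>\<omega>. (X i \<omega>)\<^sup>2)"
  shows "integrable M (\<lambda>\<omega>. (\<Sum>i\<in>I. X i \<omega>)\<^sup>2)"
    and "expectation (\<lambda>\<omega>. (\<Sum>i\<in>I. X i \<omega>)\<^sup>2) = (\<Sum>i\<in>I. expectation (\<lambda>\<omega>. (X i \<omega>)\<^sup>2))"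
proof -
  have cross: "integrable M (\<lambda>\<omega>. X i \<omega> * X j \<omega>) \<and> expectation (\<lambda>\<omega>. X i \<omega> * X j \<omega>) = 0"
    if ij: "i \<in> I" "j \<in> I" "i \<noteq> j" for i j
  proof -
    have "indep_vars (\<lambda>_. borel) X {i, j}" using ij by (intro indep_vars_subset[OF ind]) auto
    then have "indep_var borel (X i) borel (\<lambda>\<omega>. \<Sum>j\<in>{j}. X j \<omega>)"
      using ij by (intro indep_vars_sum) auto
    then have iv: "indep_var borel (X i) borel (X j)" by simp
    then show ?thesis
      using indep_var_integrable[OF iv] indep_var_lebesgue_integral[OF iv] int mean ij by auto
  qed
  have all: "integrable M (\<lambda>\<omega>. X i \<omega> * X j \<omega>)" if "i \<in> I" "j \<in> I" for i j
    using cross[of i j] sq[of i] that by (cases "i = j") (auto simp: power2_eq_square)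
  have eq: "(\<Sum>i\<in>I. X i \<omega>)\<^sup>2 = (\<Sum>i\<in>I. \<Sum>j\<in>I. X i \<omega> * X j \<omega>)" for \<omega>
    by (simp add: power2_eq_square sum_product)
  show "integrable M (\<lambda>\<omega>. (\<Sum>i\<in>I. X i \<omega>)\<^sup>2)"
    unfolding eq using all by auto
  have "expectation (\<lambda>\<omega>. (\<Sum>i\<in>I. X i \<omega>)\<^sup>2) = (\<Sum>i\<in>I. \<Sum>j\<in>I. expectation (\<lambda>\<omega>. X i \<omega> * X j \<omega>))"
    unfolding eq using all by (simp add: Bochner_Integration.integral_sum)
  also have "\<dots> = (\<Sum>i\<in>I. \<Sum>j\<in>I. if j = i then expectation (\<lambda>\<omega>. (X i \<omega>)\<^sup>2) else 0)"
    using cross by (intro sum.cong) (auto simp: power2_eq_square)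
  also have "\<dots> = (\<Sum>i\<in>I. expectation (\<lambda>\<omega>. (X i \<omega>)\<^sup>2))"
    using I by (simp add: sum.delta)
  finally show "expectation (\<lambda>\<omega>. (\<Sum>i\<in>I. X i \<omega>)\<^sup>2) = (\<Sum>i\<in>I. expectation (\<lambda>\<omega>. (X i \<omega>)\<^sup>2))" .
qed

section \<open>Order statistics and minimizers of the Legendre transform\<close>

lemma card_Collect_nth_sort:
  "card {j\<in>{1..K}. P (a j)} = length (filter P (sort (map a [1..<Suc K])))"
proof -
  have "length (filter P (sort (map a [1..<Suc K]))) = length (filter P (map a [1..<Suc K]))"
    by (metis filter_sort length_sort)
  also have "\<dots> = length (filter (P \<circ> a) [1..<Suc K])" by (simp add: filter_map del: upt_Suc)
  also have "\<dots> = card (set (filter (P \<circ> a) [1..<Suc K]))" by (simp add: distinct_card[symmetric] del: upt_Suc)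
  also have "set (filter (P \<circ> a) [1..<Suc K]) = {j\<in>{1..K}. P (a j)}" by auto
  finally show ?thesis by simp
qed

lemma length_filter_ge_of_suffix:
  assumes "\<And>i. m \<le> i \<Longrightarrow> i < length xs \<Longrightarrow> P (xs ! i)"
  shows "length xs - m \<le> length (filter P xs)"
proof -
  have "filter P (drop m xs) = drop m xs"
    using assms by (auto simp: filter_id_conv in_set_conv_nth)
  then have "length (filter P xs) = length (filter P (take m xs)) + (length xs - m)"
    by (metis append_take_drop_id filter_append length_append length_drop)
  then show ?thesis by simp
qed

lemma length_filter_ge_of_prefix:
  assumes "\<And>i. i < m \<Longrightarrow> P (xs ! i)" "m \<le> length xs"
  shows "m \<le> length (filter P xs)"
proof -
  have "filter P (take m xs) = take m xs"
    using assms by (auto simp: filter_id_conv in_set_conv_nth)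
  then have "length (filter P xs) = m + length (filter P (drop m xs))"
    using assms(2) by (metis append_take_drop_id filter_append length_append length_take min.absorb2)
  then show ?thesis by simp
qed

text \<open>
  If the \<open>k\<close>-th smallest value exceeded \<open>t\<close>, so would all the \<open>K - k + 1\<close> values from rank \<open>k\<close> on.
\<close>

lemma order_stat_le:
  assumes k: "1 \<le> k" "k \<le> K" and few: "card {j\<in>{1..K}. t < a j} \<le> K - k"
  shows "order_stat K a k \<le> t"
proof (rule ccontr)
  define xs where "xs = sort (map a [1..<Suc K])"
  have len: "length xs = K" and sorted: "sorted xs" by (simp_all add: xs_def del: upt_Suc)
  assume "\<not> order_stat K a k \<le> t"
  then have gt: "t < xs ! (k - 1)" by (simp add: order_stat_def xs_def)
  have "t < xs ! i" if "k - 1 \<le> i" "i < length xs" for i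
    using gt that sorted_nth_mono[OF sorted, of "k - 1" i] by simp
  then have "length xs - (k - 1) \<le> length (filter (\<lambda>x. t < x) xs)"
    by (rule length_filter_ge_of_suffix)
  then show False
    using few k card_Collect_nth_sort[of K "\<lambda>x. t < x" a] unfolding len xs_def[symmetric] by simp
qed

lemma order_stat_ge:
  assumes k: "1 \<le> k" "k \<le> K" and few: "card {j\<in>{1..K}. a j < t} < k"
  shows "t \<le> order_stat K a k"
proof (rule ccontr)
  define xs where "xs = sort (map a [1..<Suc K])"
  have len: "length xs = K" and sorted: "sorted xs" by (simp_all add: xs_def del: upt_Suc)
  assume "\<not> t \<le> order_stat K a k"
  then have gt: "xs ! (k - 1) < t" by (simp add: order_stat_def xs_def)
  have "xs ! i < t" if "i < k" for i
  proof -
    have "i \<le> k - 1" "k - 1 < length xs" using that k len by arith+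
    then show ?thesis using gt sorted_nth_mono[OF sorted] by (meson le_less_trans)
  qed
  then have "k \<le> length (filter (\<lambda>x. x < t) xs)"
    using k len by (intro length_filter_ge_of_prefix) auto
  then show False
    using few k card_Collect_nth_sort[of K "\<lambda>x. x < t" a] unfolding xs_def[symmetric] by simp
qed

lemma mid_ranks_eq:
  assumes "K + 1 = 4 * m"
  shows "mid_ranks K = {m..3 * m}"
proof -
  have "real K + 1 = 4 * real m" using assms by (metis of_nat_1 of_nat_add of_nat_mult of_nat_numeral)
  then show ?thesis by (auto simp: mid_ranks_def)
qed

text \<open>
  The ranks in \<open>mid_ranks K\<close> run from \<open>m\<close> to \<open>3 m\<close>, and \<open>K - 3 m = m - 1\<close>, so the largest and the
  smallest of these ranks tolerate the same number of outliers on their side.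
\<close>

lemma block_estimators_close:
  assumes K: "K + 1 = 4 * m"
    and up: "card {j\<in>{1..K}. c + r < block_mean x (B j) \<bullet> v} < m"
    and lo: "card {j\<in>{1..K}. block_mean x (B j) \<bullet> v < c - r} < m"
  shows "\<bar>trimmed_block_mean K B x v - c\<bar> \<le> r" and "\<bar>median_block_mean K B x v - c\<bar> \<le> r"
proof -
  define s where "s = order_stat K (\<lambda>j. block_mean x (B j) \<bullet> v)"
  have s: "c - r \<le> s k \<and> s k \<le> c + r" if "k \<in> mid_ranks K" for k
  proof -
    have k: "m \<le> k" "k \<le> 3 * m" "1 \<le> m" using that K by (auto simp: mid_ranks_eq)
    show ?thesis unfolding s_def
      using k K up lo by (auto intro!: order_stat_le order_stat_ge)
  qed
  have ne: "card (mid_ranks K) > 0" using K by (simp add: mid_ranks_eq)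
  have "(K + 1) div 2 \<in> mid_ranks K" using K by (simp add: mid_ranks_eq)
  then show "\<bar>median_block_mean K B x v - c\<bar> \<le> r"
    using s[of "(K + 1) div 2"] by (auto simp: median_block_mean_def s_def[symmetric] abs_le_iff)
  have "(\<Sum>k\<in>mid_ranks K. s k) \<le> real (card (mid_ranks K)) * (c + r)"
    using sum_bounded_above[of "mid_ranks K" s "c + r"] s by simp
  moreover have "real (card (mid_ranks K)) * (c - r) \<le> (\<Sum>k\<in>mid_ranks K. s k)"
    using sum_bounded_below[of "mid_ranks K" "c - r" s] s by simp
  ultimately show "\<bar>trimmed_block_mean K B x v - c\<bar> \<le> r"
    using ne by (simp add: trimmed_block_mean_def s_def[symmetric] abs_le_iff field_simps)
qed

text \<open>
  The value of the Legendre transform at \<open>\<mu>\<close>, and hence its minimum, is at most \<open>r\<close>. For \<open>v \<in> S\<close> one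
  has \<open>\<langle>\<nu> - \<mu>, v\<rangle> = (\<langle>\<nu>, v\<rangle> - h v) + (h v - \<langle>\<mu>, v\<rangle>)\<close>, and both terms are at most \<open>r\<close>.
\<close>

lemma pnorm_arg_min_legendre_le:
  assumes close: "\<And>v. v \<in> S \<Longrightarrow> \<bar>h v - \<mu> \<bullet> v\<bar> \<le> r"
    and min: "is_arg_min (legendre_on S h) (\<lambda>_. True) \<nu>"
  shows "pnorm S (\<nu> - \<mu>) \<le> ereal (2 * r)"
proof -
  have "legendre_on S h \<nu> \<le> legendre_on S h \<mu>"
    using min by (simp add: is_arg_min_linorder)
  also have "\<dots> \<le> ereal r"
    unfolding legendre_on_def
  proof (rule SUP_least)
    fix v assume "v \<in> S"
    then show "ereal (\<mu> \<bullet> v - h v) \<le> ereal r" using close[of v] by (simp add: abs_le_iff)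
  qed
  finally have le: "legendre_on S h \<nu> \<le> ereal r" .
  show ?thesis unfolding pnorm_def
  proof (rule SUP_least)
    fix v assume v: "v \<in> S"
    have "ereal (\<nu> \<bullet> v - h v) \<le> legendre_on S h \<nu>"
      unfolding legendre_on_def using v by (rule SUP_upper)
    then have "\<nu> \<bullet> v - h v \<le> r" using le by (metis ereal_less_eq(3) order_trans)
    then show "ereal (v \<bullet> (\<nu> - \<mu>)) \<le> ereal (2 * r)"
      using close[OF v] inner_commute[of v \<nu>] inner_commute[of v \<mu>]
      by (simp add: inner_diff_right abs_le_iff)
  qed
qed

lemma card_blocks_meeting_le:
  assumes "disjoint_family_on B J" "finite A"
  shows "card {k\<in>J. B k \<inter> A \<noteq> {}} \<le> card A"
proof -
  define p where "p k = (SOME i. i \<in> B k \<inter> A)" for k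
  have p: "p k \<in> B k \<inter> A" if "k \<in> {k\<in>J. B k \<inter> A \<noteq> {}}" for k
    using that unfolding p_def some_in_eq by simp
  have "inj_on p {k\<in>J. B k \<inter> A \<noteq> {}}"
  proof (rule inj_onI)
    fix k l assume k: "k \<in> {k\<in>J. B k \<inter> A \<noteq> {}}" and l: "l \<in> {k\<in>J. B k \<inter> A \<noteq> {}}" and "p k = p l"
    then have "p k \<in> B k \<inter> B l" using p[OF k] p[OF l] by auto
    then show "k = l" using assms(1) k l by (auto simp: disjoint_family_on_def)
  qed
  moreover have "p ` {k\<in>J. B k \<inter> A \<noteq> {}} \<subseteq> A" using p by auto
  ultimately show ?thesis using assms(2) by (metis card_inj_on_le)
qed

section \<open>Corrupted blocks and the rate\<close>

text \<open>
  A bad block either contains a corrupted observation, which happens for fewer than \<open>K / 16\<close>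
  blocks, or is bad already for the clean sample and then contributes \<open>1\<close> to the sum of ramps.
\<close>

lemma card_corrupted_large_blocks:
  fixes x xt :: "nat \<Rightarrow> real ^ 'd"
  assumes N: "0 < N" and B: "equal_blocks N K B" and K: "K + 1 = 4 * m" and n: "16 * n < K"
    and A: "A \<subseteq> {1..N}" "card A \<le> n" and x: "\<And>i. i \<in> {1..N} - A \<Longrightarrow> x i = xt i" and r: "0 < r"
    and few: "(\<Sum>k\<in>{1..K}. ramp (r * (real N / real K)) ((\<Sum>i\<in>B k. xt i - \<mu>) \<bullet> w)) \<le> 3 * real K / 16"
  shows "card {k\<in>{1..K}. r < (block_mean x (B k) - \<mu>) \<bullet> w} < m"
proof -
  define b where "b = real N / real K"
  have Kpos: "0 < K" using K by (cases K) auto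
  have b: "0 < b" using N Kpos by (simp add: b_def)
  have cardB: "real (card (B k)) = b" if "k \<in> {1..K}" for k using B that by (simp add: equal_blocks_def b_def)
  define L where "L = {k\<in>{1..K}. r * b \<le> (\<Sum>i\<in>B k. xt i - \<mu>) \<bullet> w}"
  define Q where "Q = {k\<in>{1..K}. B k \<inter> A \<noteq> {}}"
  have sub: "{k\<in>{1..K}. r < (block_mean x (B k) - \<mu>) \<bullet> w} \<subseteq> Q \<union> L"
  proof
    fix k assume k: "k \<in> {k\<in>{1..K}. r < (block_mean x (B k) - \<mu>) \<bullet> w}"
    show "k \<in> Q \<union> L"
    proof (cases "B k \<inter> A = {}")
      case True
      have "B k \<subseteq> {1..N}" using B k by (auto simp: equal_blocks_def)
      with True have eq: "(\<Sum>i\<in>B k. x i) = (\<Sum>i\<in>B k. xt i)" 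
        by (intro sum.cong refl x) blast
      have "(\<Sum>i\<in>B k. xt i - \<mu>) = b *\<^sub>R (block_mean x (B k) - \<mu>)"
        using cardB[of k] k b by (simp add: block_mean_def eq sum_subtractf scaleR_diff_right sum_constant_scaleR
            del: sum_constant)
      then have "(\<Sum>i\<in>B k. xt i - \<mu>) \<bullet> w = b * ((block_mean x (B k) - \<mu>) \<bullet> w)" by simp
      moreover have "r * b \<le> b * ((block_mean x (B k) - \<mu>) \<bullet> w)"
        using k b by (simp add: mult.commute)
      ultimately show ?thesis using k by (simp add: L_def)
    qed (use k in \<open>simp add: Q_def\<close>)
  qed
  have finL: "finite L" and finQ: "finite Q" by (simp_all add: L_def Q_def)
  have "real (card L) = (\<Sum>k\<in>L. ramp (r * b) ((\<Sum>i\<in>B k. xt i - \<mu>) \<bullet> w))"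
    using r b by (simp add: L_def ramp_eq_1)
  also have "\<dots> \<le> (\<Sum>k\<in>{1..K}. ramp (r * b) ((\<Sum>i\<in>B k. xt i - \<mu>) \<bullet> w))"
    by (intro sum_mono2) (auto simp: L_def ramp_bounds)
  finally have L: "real (card L) \<le> 3 * real K / 16" using few by (simp add: b_def)
  have "card Q \<le> card A" unfolding Q_def
    using B A(1) by (intro card_blocks_meeting_le) (auto simp: equal_blocks_def finite_subset)
  then have Q: "16 * card Q < K" using A(2) n by linarith
  have "card {k\<in>{1..K}. r < (block_mean x (B k) - \<mu>) \<bullet> w} \<le> card Q + card L"
    using card_mono[OF _ sub] card_Un_le[of Q L] finL finQ by (meson finite_UnI le_trans)
  moreover have "real (16 * card L) \<le> real (3 * K)" using L by simp
  then have "16 * card L \<le> 3 * K" by (simp only: of_nat_le_iff)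
  ultimately show ?thesis using Q K by linarith
qed

lemma block_estimators_close_corrupted:
  fixes x xt :: "nat \<Rightarrow> real ^ 'd"
  assumes N: "0 < N" and B: "equal_blocks N K B" and K: "K + 1 = 4 * m" and n: "16 * n < K"
    and A: "A \<subseteq> {1..N}" "card A \<le> n" and x: "\<And>i. i \<in> {1..N} - A \<Longrightarrow> x i = xt i" and r: "0 < r"
    and few: "\<And>w. w \<in> {v, - v} \<Longrightarrow>
      (\<Sum>k\<in>{1..K}. ramp (r * (real N / real K)) ((\<Sum>i\<in>B k. xt i - \<mu>) \<bullet> w)) \<le> 3 * real K / 16"
  shows "\<bar>trimmed_block_mean K B x v - \<mu> \<bullet> v\<bar> \<le> r" and "\<bar>median_block_mean K B x v - \<mu> \<bullet> v\<bar> \<le> r"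
proof -
  have card: "card {k\<in>{1..K}. r < (block_mean x (B k) - \<mu>) \<bullet> w} < m" if "w \<in> {v, - v}" for w
    using card_corrupted_large_blocks[OF N B K n A x r few[OF that]] .
  have "card {k\<in>{1..K}. \<mu> \<bullet> v + r < block_mean x (B k) \<bullet> v} < m"
    using card[of v] by (simp add: inner_diff_left less_diff_eq add.commute)
  moreover have "card {k\<in>{1..K}. block_mean x (B k) \<bullet> v < \<mu> \<bullet> v - r} < m"
    using card[of "- v"] by (simp add: inner_diff_left less_diff_eq add.commute)
  ultimately show "\<bar>trimmed_block_mean K B x v - \<mu> \<bullet> v\<bar> \<le> r" "\<bar>median_block_mean K B x v - \<mu> \<bullet> v\<bar> \<le> r"
    using block_estimators_close[OF K] by blast+
qed

text \<open>
  The complexity is a nonnegative integral while the maximum over \<open>T\<close> may be negative, so the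
  positive part of the maximum serves as an intermediate quantity. The pseudo-norm over an
  arbitrary \<open>S\<close> may fail to be measurable; monotonicity of the nonnegative integral holds
  nevertheless.
\<close>

lemma ereal_expectation_max_le_rademacher_complexity:
  assumes M: "prob_space M" and T: "finite T" "T \<noteq> {}" "T \<subseteq> S"
    and int: "integrable M (\<lambda>\<omega>. \<Sum>i\<in>{1..N}. \<epsilon> i \<omega> *\<^sub>R (Xt i \<omega> - \<mu>))"
  shows "ereal (1 / sqrt (real N) * (\<integral>\<omega>. max_over T (\<lambda>v. (\<Sum>i\<in>{1..N}. \<epsilon> i \<omega> *\<^sub>R (Xt i \<omega> - \<mu>)) \<bullet> v) \<partial>M))
    \<le> rademacher_complexity M S N \<epsilon> Xt \<mu>"
proof -
  interpret prob_space M by fact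
  define s where "s \<omega> = (\<Sum>i\<in>{1..N}. \<epsilon> i \<omega> *\<^sub>R (Xt i \<omega> - \<mu>))" for \<omega>
  define G where "G \<omega> = 1 / sqrt (real N) * max_over T (\<lambda>v. s \<omega> \<bullet> v)" for \<omega>
  have int_G: "integrable M G"
    unfolding G_def using int by (intro integrable_mult_right integrable_max_over T) (auto simp: s_def)
  have G_le: "ereal (G \<omega>) \<le> pnorm S ((1 / sqrt (real N)) *\<^sub>R s \<omega>)" for \<omega>
  proof -
    obtain v where v: "v \<in> T" "max_over T (\<lambda>v. s \<omega> \<bullet> v) = s \<omega> \<bullet> v"
      using max_over_attained[OF T(1,2)] by blast
    have "ereal (v \<bullet> ((1 / sqrt (real N)) *\<^sub>R s \<omega>)) \<le> pnorm S ((1 / sqrt (real N)) *\<^sub>R s \<omega>)"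
      unfolding pnorm_def using v(1) T(3) by (intro SUP_upper) auto
    then show ?thesis unfolding G_def v(2) by (simp add: inner_commute[of v])
  qed
  have "ereal (expectation G) \<le> ereal (expectation (\<lambda>\<omega>. max 0 (G \<omega>)))"
    using int_G by (auto intro!: integral_mono)
  also have "\<dots> = enn2ereal (ennreal (expectation (\<lambda>\<omega>. max 0 (G \<omega>))))"
    by (simp add: enn2ereal_ennreal)
  also have "ennreal (expectation (\<lambda>\<omega>. max 0 (G \<omega>))) = (\<integral>\<^sup>+\<omega>. ennreal (max 0 (G \<omega>)) \<partial>M)"
    using int_G by (intro nn_integral_eq_integral[symmetric]) auto
  also have "enn2ereal \<dots> \<le> rademacher_complexity M S N \<epsilon> Xt \<mu>"
  proof -
    have "ennreal (max 0 (G \<omega>)) \<le> e2ennreal (pnorm S ((1 / sqrt (real N)) *\<^sub>R s \<omega>))" for \<omega>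
      using e2ennreal_mono[OF G_le[of \<omega>]] by (simp add: max_def ennreal_neg)
    then show ?thesis
      unfolding rademacher_complexity_def s_def[symmetric] less_eq_ennreal.rep_eq[symmetric]
      by (intro nn_integral_mono)
  qed
  finally show ?thesis
    unfolding G_def s_def by (simp add: integral_mult_right_zero)
qed

text \<open>
  The rate is a maximum of two terms. The second one bounds the second moments of the block sums
  in terms of \<open>\<rho> = r N / K\<close>, and the first one bounds the expected maximum of the signed sums.
\<close>

lemma prob_few_large_blocks_of_rate:
  fixes S T :: "(real ^ 'd) set" and Xt :: "nat \<Rightarrow> 'a \<Rightarrow> real ^ 'd" and r :: real
  assumes M: "prob_space M" and N: "0 < N" and K: "0 < K"
    and Xt: "prob_space.indep_vars M (\<lambda>_. borel) Xt {1..N}"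
    and mean: "\<And>i. i \<in> {1..N} \<Longrightarrow> integrable M (Xt i) \<and> (\<integral>\<omega>. Xt i \<omega> \<partial>M) = \<mu>"
    and C: "pos_semidef C"
    and cov: "\<And>i. i \<in> {1..N} \<Longrightarrow>
           integrable M (\<lambda>\<omega>. outer_square (Xt i \<omega> - \<mu>)) \<and>
           loewner_le (\<integral>\<omega>. outer_square (Xt i \<omega> - \<mu>) \<partial>M) C"
    and rad: "\<And>i. i \<in> {1..N} \<Longrightarrow> rademacher M (\<epsilon> i)"
    and \<epsilon>: "prob_space.indep_vars M (\<lambda>_. borel) \<epsilon> {1..N}"
    and \<epsilon>Xt: "indep_families M {1..N} \<epsilon> Xt"
    and B: "equal_blocks N K B"
    and T: "finite T" "T \<noteq> {}" "T \<subseteq> S" and r: "0 < r" "rate M S N K \<epsilon> Xt \<mu> C \<le> ereal r"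
  defines "E \<equiv> {\<omega>\<in>space M. \<forall>v\<in>T.
    (\<Sum>k\<in>{1..K}. ramp (r * (real N / real K)) ((\<Sum>i\<in>B k. Xt i \<omega> - \<mu>) \<bullet> v)) \<le> 3 * real K / 16}"
  shows "E \<in> sets M" and "1 - exp (- real K / 512) \<le> measure M E"
proof -
  interpret prob_space M by fact
  interpret symmetrized_sample M "{1..N}" "\<lambda>i \<omega>. Xt i \<omega> - \<mu>" "\<lambda>i \<omega>. \<epsilon> i \<omega> *\<^sub>R (Xt i \<omega> - \<mu>)"
    using N by (intro symmetrized_sample_rademacher \<epsilon> Xt \<epsilon>Xt rad mean) auto
  define b where "b = real N / real K"
  have b: "0 < b" using N K by (simp add: b_def)
  have sub: "B k \<subseteq> {1..N}" and cardB: "real (card (B k)) = b" if "k \<in> {1..K}" for k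
    using B that by (auto simp: equal_blocks_def b_def)
  have split: "(\<Sum>i\<in>B k. Xt i \<omega> - \<mu>) \<bullet> v = (\<Sum>i\<in>B k. (Xt i \<omega> - \<mu>) \<bullet> v)" for k \<omega> v
    by (rule inner_sum_left)
  have moment: "integrable M (\<lambda>\<omega>. ((\<Sum>i\<in>B k. Xt i \<omega> - \<mu>) \<bullet> v)\<^sup>2) \<and>
      expectation (\<lambda>\<omega>. ((\<Sum>i\<in>B k. Xt i \<omega> - \<mu>) \<bullet> v)\<^sup>2) \<le> b * (norm (matrix_sqrt C *v v))\<^sup>2"
    if k: "k \<in> {1..K}" for k v
  proof -
    have i: "i \<in> {1..N}" if "i \<in> B k" for i using sub[OF k] that by blast
    have fin: "finite (B k)" using sub[OF k] finite_subset by blast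
    have ind: "indep_vars (\<lambda>_. borel) (\<lambda>i \<omega>. (Xt i \<omega> - \<mu>) \<bullet> v) (B k)"
      using indep_vars_compose2[OF indep_vars_subset[OF Xt sub[OF k]], of "\<lambda>_ x. (x - \<mu>) \<bullet> v" "\<lambda>_. borel"]
      by simp
    have int: "integrable M (\<lambda>\<omega>. (Xt i \<omega> - \<mu>) \<bullet> v)" "expectation (\<lambda>\<omega>. (Xt i \<omega> - \<mu>) \<bullet> v) = 0"
      if "i \<in> B k" for i
      using int_Y[OF i[OF that]] mean_Y[OF i[OF that]] by (auto simp: integral_inner_left)
    have sq: "integrable M (\<lambda>\<omega>. ((Xt i \<omega> - \<mu>) \<bullet> v)\<^sup>2)"
      "expectation (\<lambda>\<omega>. ((Xt i \<omega> - \<mu>) \<bullet> v)\<^sup>2) \<le> (norm (matrix_sqrt C *v v))\<^sup>2" if "i \<in> B k" for i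
      using directional_second_moment_le[OF C conjunct1[OF cov[OF i[OF that]]] conjunct2[OF cov[OF i[OF that]]]]
      by auto
    have "expectation (\<lambda>\<omega>. (\<Sum>i\<in>B k. (Xt i \<omega> - \<mu>) \<bullet> v)\<^sup>2)
        = (\<Sum>i\<in>B k. expectation (\<lambda>\<omega>. ((Xt i \<omega> - \<mu>) \<bullet> v)\<^sup>2))"
      by (rule expectation_square_sum_centered(2)[OF fin ind int sq(1)])
    also have "\<dots> \<le> real (card (B k)) * (norm (matrix_sqrt C *v v))\<^sup>2"
      by (rule sum_bounded_above) (rule sq(2))
    finally show ?thesis
      unfolding split using expectation_square_sum_centered(1)[OF fin ind int sq(1)] cardB[OF k] by simp
  qed
  have var_rate: "64 * (b * (norm (matrix_sqrt C *v v))\<^sup>2) \<le> (r * b)\<^sup>2" if v: "v \<in> T" for v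
  proof -
    define s where "s = norm (matrix_sqrt C *v v)"
    have "ereal s \<le> (SUP v\<in>S. ereal (norm (matrix_sqrt C *v v)))"
      unfolding s_def using v T(3) by (intro SUP_upper) auto
    then have "ereal s * ereal (sqrt (64 * real K / real N))
        \<le> (SUP v\<in>S. ereal (norm (matrix_sqrt C *v v))) * ereal (sqrt (64 * real K / real N))"
      by (intro ereal_mult_right_mono) auto
    also have "\<dots> \<le> ereal r" using r(2) by (simp add: rate_def)
    finally have "s * sqrt (64 * real K / real N) \<le> r" by simp
    moreover have "0 \<le> s" by (simp add: s_def)
    ultimately have "(s * sqrt (64 * real K / real N))\<^sup>2 \<le> r\<^sup>2" by (intro power_mono) auto
    then have "s\<^sup>2 * (64 / b) \<le> r\<^sup>2" by (simp add: power_mult_distrib b_def)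
    then have "s\<^sup>2 * (64 / b) * b\<^sup>2 \<le> r\<^sup>2 * b\<^sup>2" by (rule mult_right_mono) simp
    then show ?thesis using b by (simp add: s_def power_mult_distrib power2_eq_square mult_ac)
  qed
  define m where "m = expectation (\<lambda>\<omega>. max_over T (\<lambda>v. (\<Sum>i\<in>{1..N}. \<epsilon> i \<omega> *\<^sub>R (Xt i \<omega> - \<mu>)) \<bullet> v))"
  have rad_rate: "64 * m \<le> r * b * real (card {1..K})"
  proof -
    have "ereal (1 / sqrt (real N) * m) \<le> rademacher_complexity M S N \<epsilon> Xt \<mu>"
      unfolding m_def using int_Z by (intro ereal_expectation_max_le_rademacher_complexity M T) auto
    then have "ereal (64 / sqrt (real N)) * ereal (1 / sqrt (real N) * m)
        \<le> ereal (64 / sqrt (real N)) * rademacher_complexity M S N \<epsilon> Xt \<mu>"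
      by (intro ereal_mult_left_mono) auto
    also have "\<dots> \<le> ereal r" using r(2) by (simp add: rate_def)
    finally have "64 * m / real N \<le> r" using N by simp
    then show ?thesis using N K by (simp add: b_def field_simps)
  qed
  have var: "64 * expectation (\<lambda>\<omega>. ((\<Sum>i\<in>B k. Xt i \<omega> - \<mu>) \<bullet> v)\<^sup>2) \<le> (r * b)\<^sup>2"
    if "k \<in> {1..K}" "v \<in> T" for k v
    using moment[OF that(1), of v] var_rate[OF that(2)] by linarith
  have disj: "disjoint_family_on B {1..K}" and union: "(\<Union>k\<in>{1..K}. B k) = {1..N}"
    using B by (auto simp: equal_blocks_def)
  have rb: "0 < r * b" using r b by simp
  note few = prob_few_large_blocks[OF T(1,2) _ _ disj union rb _ var rad_rate[unfolded m_def]]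
  show "E \<in> sets M" "1 - exp (- real K / 512) \<le> measure M E"
    using few moment K unfolding E_def b_def[symmetric] by auto
qed

section \<open>The error bound\<close>

theorem theorem5:
  fixes M :: "'a measure"
    and S :: "(real ^ 'd) set"
    and N K n_corr :: nat
    and Xt X :: "nat \<Rightarrow> 'a \<Rightarrow> real ^ 'd"
    and corrupted :: "'a \<Rightarrow> nat set"
    and \<epsilon> :: "nat \<Rightarrow> 'a \<Rightarrow> real"
    and \<mu> :: "real ^ 'd"
    and C :: "real ^ 'd ^ 'd"
    and B :: "nat \<Rightarrow> nat set"
  assumes "prob_space M"
    and "symmetric_set S"
    and "0 < N"
    and "prob_space.indep_vars M (\<lambda>_. borel) Xt {1..N}"
    and "\<And>i. i \<in> {1..N} \<Longrightarrow> integrable M (Xt i) \<and> (\<integral>\<omega>. Xt i \<omega> \<partial>M) = \<mu>"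
    and "pos_semidef C"
    and "\<And>i. i \<in> {1..N} \<Longrightarrow>
           integrable M (\<lambda>\<omega>. outer_square (Xt i \<omega> - \<mu>)) \<and>
           loewner_le (\<integral>\<omega>. outer_square (Xt i \<omega> - \<mu>) \<partial>M) C"
    and "\<And>i. i \<in> {1..N} \<Longrightarrow> rademacher M (\<epsilon> i)"
    and "prob_space.indep_vars M (\<lambda>_. borel) \<epsilon> {1..N}"
    and "indep_families M {1..N} \<epsilon> Xt"
    and "\<And>\<omega>. \<omega> \<in> space M \<Longrightarrow> corrupted \<omega> \<subseteq> {1..N} \<and> card (corrupted \<omega>) \<le> n_corr"
    and "\<And>\<omega> i. \<omega> \<in> space M \<Longrightarrow> i \<in> {1..N} - corrupted \<omega> \<Longrightarrow> X i \<omega> = Xt i \<omega>"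
    and "equal_blocks N K B"
    and "4 dvd K + 1"
    and "16 * n_corr < K"
  shows "\<exists>E\<in>sets M. measure M E \<ge> 1 - exp (- real K / 512) \<and>
    (\<forall>\<omega>\<in>E.
       (\<forall>\<mu>f. is_arg_min (legendre_on S (trimmed_block_mean K B (\<lambda>i. X i \<omega>))) (\<lambda>_. True) \<mu>f \<longrightarrow>
          pnorm S (\<mu>f - \<mu>) \<le> 2 * rate M S N K \<epsilon> Xt \<mu> C) \<and>
       (\<forall>\<mu>g. is_arg_min (legendre_on S (median_block_mean K B (\<lambda>i. X i \<omega>))) (\<lambda>_. True) \<mu>g \<longrightarrow>
          pnorm S (\<mu>g - \<mu>) \<le> 2 * rate M S N K \<epsilon> Xt \<mu> C))"
proof -
  interpret prob_space M by fact
  obtain m where m: "K + 1 = 4 * m" using \<open>4 dvd K + 1\<close> by (auto elim: dvdE)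
  then have K: "0 < K" by (cases K) auto
  define R where "R = rate M S N K \<epsilon> Xt \<mu> C"
  have "0 \<le> ereal (64 / sqrt (real N)) * rademacher_complexity M S N \<epsilon> Xt \<mu>"
    by (simp add: rademacher_complexity_def enn2ereal_nonneg)
  then have R_nonneg: "0 \<le> R" by (simp add: R_def rate_def le_max_iff_disj)
  show ?thesis
  proof (cases "S = {} \<or> R = \<infinity>")
    case True
    then have "pnorm S x \<le> 2 * R" for x by (auto simp: pnorm_def bot_ereal_def)
    then show ?thesis
      by (intro bexI[of _ "space M"]) (auto simp: prob_space R_def)
  next
    case False
    then obtain r0 where r0: "R = ereal r0" "0 \<le> r0" using R_nonneg by (cases R) auto
    obtain D where D: "countable D" "D \<subseteq> S" "S \<subseteq> closure D" using separable by blast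
    have D_ne: "D \<noteq> {}" using D(3) False by auto
    define d where "d = from_nat_into D"
    have D_range: "D = range d" unfolding d_def using D(1) D_ne by (simp add: range_from_nat_into)
    \<comment> \<open>A strict excess over the rate makes the radius positive even if the rate is zero.\<close>
    define r where "r n = r0 + 1 / real (Suc n)" for n
    have r_pos: "0 < r n" for n using r0(2) by (simp add: r_def add_nonneg_pos)
    have r_anti: "r n \<le> r l" if "l \<le> n" for l n
      unfolding r_def using that by (intro add_left_mono divide_left_mono) auto
    define excess where "excess n \<omega> v =
      (\<Sum>k\<in>{1..K}. ramp (r n * (real N / real K)) ((\<Sum>i\<in>B k. Xt i \<omega> - \<mu>) \<bullet> v))" for n \<omega> v
    define E where "E n = {\<omega>\<in>space M. \<forall>v\<in>d ` {..n}. excess n \<omega> v \<le> 3 * real K / 16}" for n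
    have E: "E n \<in> events" "1 - exp (- real K / 512) \<le> prob (E n)" for n
    proof -
      have T: "finite (d ` {..n})" "d ` {..n} \<noteq> {}" "d ` {..n} \<subseteq> S" using D(2) D_range by auto
      have "rate M S N K \<epsilon> Xt \<mu> C \<le> ereal (r n)" unfolding R_def[symmetric] r0(1) by (simp add: r_def)
      note few = prob_few_large_blocks_of_rate[OF assms(1,3) K assms(4-10,13) T r_pos this]
      show "E n \<in> events" unfolding E_def excess_def by (rule few(1))
      show "1 - exp (- real K / 512) \<le> prob (E n)" unfolding E_def excess_def by (rule few(2))
    qed
    have excess_mono: "excess l \<omega> v \<le> excess n \<omega> v" if "l \<le> n" for l n \<omega> v
      unfolding excess_def using r_pos[of n] r_anti[OF that] K \<open>0 < N\<close>
      by (intro sum_mono ramp_antimono mult_right_mono) auto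
    have "decseq E"
    proof (rule decseq_SucI, rule subsetI)
      fix n \<omega> assume \<omega>: "\<omega> \<in> E (Suc n)"
      have "excess n \<omega> v \<le> 3 * real K / 16" if "v \<in> d ` {..n}" for v
      proof -
        have "v \<in> d ` {..Suc n}" using that by auto
        then have "excess (Suc n) \<omega> v \<le> 3 * real K / 16" using \<omega> unfolding E_def by blast
        then show ?thesis using excess_mono[of n "Suc n" \<omega> v] by simp
      qed
      then show "\<omega> \<in> E n" using \<omega> unfolding E_def by blast
    qed
    then have "(\<lambda>n. prob (E n)) \<longlonglongrightarrow> prob (\<Inter>n. E n)"
      using E(1) by (intro finite_Lim_measure_decseq) auto
    then have prob_E: "1 - exp (- real K / 512) \<le> prob (\<Inter>n. E n)"
      using E(2) by (intro LIMSEQ_le_const) auto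
    have few: "excess n \<omega> v \<le> 3 * real K / 16" if \<omega>: "\<omega> \<in> (\<Inter>n. E n)" and v: "v \<in> S" for n \<omega> v
    proof -
      \<comment> \<open>The bound at a point of the dense set is known at late stages only, where the radius is
        smaller and hence the excess larger. Continuity extends it to \<open>S\<close>.\<close>
      have "D \<subseteq> {v. excess n \<omega> v \<le> 3 * real K / 16}"
      proof
        fix v assume "v \<in> D"
        then obtain j where j: "v = d j" using D_range by blast
        have "\<omega> \<in> E (max n j)" using \<omega> by blast
        then have "excess (max n j) \<omega> v \<le> 3 * real K / 16" using j by (auto simp: E_def)
        then show "v \<in> {v. excess n \<omega> v \<le> 3 * real K / 16}"
          using excess_mono[of n "max n j" \<omega> v] by simp
      qed
      moreover have "closed {v. excess n \<omega> v \<le> 3 * real K / 16}"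
        unfolding excess_def by (intro closed_Collect_le continuous_intros)
      ultimately show ?thesis using closure_minimal D(3) v by blast
    qed
    have close: "pnorm S (\<nu> - \<mu>) \<le> 2 * R"
      if \<omega>: "\<omega> \<in> (\<Inter>n. E n)"
        and h: "h = trimmed_block_mean K B (\<lambda>i. X i \<omega>) \<or> h = median_block_mean K B (\<lambda>i. X i \<omega>)"
        and min: "is_arg_min (legendre_on S h) (\<lambda>_. True) \<nu>" for \<omega> h \<nu>
    proof -
      have sp: "\<omega> \<in> space M" using \<omega> by (auto simp: E_def)
      have bound: "pnorm S (\<nu> - \<mu>) \<le> ereal (2 * r n)" for n
      proof (rule pnorm_arg_min_legendre_le[OF _ min])
        fix v assume v: "v \<in> S"
        then have "- v \<in> S" using \<open>symmetric_set S\<close> by (simp add: symmetric_set_def)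
        with v have "(\<Sum>k\<in>{1..K}. ramp (r n * (real N / real K)) ((\<Sum>i\<in>B k. Xt i \<omega> - \<mu>) \<bullet> w))
            \<le> 3 * real K / 16" if "w \<in> {v, - v}" for w
          using few[OF \<omega>, of w n] that by (auto simp: excess_def)
        note close = block_estimators_close_corrupted[OF assms(3,13) m assms(15)
            conjunct1[OF assms(11)[OF sp]] conjunct2[OF assms(11)[OF sp]] assms(12)[OF sp] r_pos this]
        show "\<bar>h v - \<mu> \<bullet> v\<bar> \<le> r n"
          using h close by auto
      qed
      show ?thesis
      proof (rule ereal_le_epsilon2)
        fix e :: real assume "0 < e"
        then obtain n where "1 / real (Suc n) < e / 2" using nat_approx_posE[of "e / 2"] by auto
        then have "ereal (2 * r n) \<le> 2 * R + ereal e" by (simp add: r_def r0(1))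
        then show "pnorm S (\<nu> - \<mu>) \<le> 2 * R + ereal e" using bound order_trans by blast
      qed
    qed
    show ?thesis
    proof (intro bexI[of _ "\<Inter>n. E n"] conjI ballI allI impI)
      show "(\<Inter>n. E n) \<in> events" using E(1) by blast
      show "1 - exp (- real K / 512) \<le> prob (\<Inter>n. E n)" by (rule prob_E)
    qed (use close in \<open>auto simp: R_def\<close>)
  qed
qed

end
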